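(* Let $G=G_1\cup\dots\cup G_t$ be a simple graph which is a disjoint union of $t$ connected non-bipartite graphs $G_i$, $i=1,\dots,t$. Then $$\min\{\nu(p_{\mathbf a+\mathbf 1_G}(G))\mid p_{\mathbf a+\mathbf 1_G}(G)\text{ is matching-critical}\}=\nu^*(G).$$ Moreover, for $k\in\mathbb N$ the following statements are equivalent: (1) $\varphi(G)+\psi(G)=k$; (2) $\min\{|\mathbf a|\ \mid\ p_{\mathbf a+\mathbf 1_G}(G)\text{ is matching-critical}\}=k$. Here $\mathbf a$ ranges over the vectors in $\mathbb N^{V(G)}$.
   Context: Graphs are finite and simple; $\mathbb N$ includes $0$. $\nu(H)$ is the maximum size of a matching of $H$. A graph $H$ is factor-critical if $H-v$ has a perfect matching for every vertex $v$; a graph is matching-critical if it is a disjoint union of factor-critical graphs. Replication. For a graph $G$ with vertices $P_1,\dots,P_d$ and a nonzero vector $\mathbf b\in\mathbb N^d$, the replication $p_{\mathbf b}(G)$ has vertex set $\bigcup_{b_i>0}A_i$, where $A_i=\{P_i=P_i^{(1)},\dots,P_i^{(b_i)}\}$ consists of $b_i$ copies of $P_i$, and edges $P_i^{(l)}P_j^{(m)}$ whenever $P_iP_j\in E(G)$. $\mathbf 1_G$ is the all-ones vector indexed by $V(G)$ and $|\mathbf a|=\sum_i a_i$. Ears. Given a graph $H'$, adding an ear to $H'$ means taking two vertices $a,b$ of $H'$ and adding a path from $a$ to $b$ all of whose vertices other than $a,b$ are new; $a=b$ is allowed (closed ear, a cycle through $a$). An ear is odd (even) if it has an odd (even) number of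 edges. A generalized ear decomposition of a connected graph $H$ is a sequence $F_0,F_1,\dots,F_s$ with union $H$ such that $F_0$ is a cycle (counted as an odd or even ear according to its length) or a bridge of $H$, and for $i\ge 1$ each $F_i$ is either an ear added to $F_0\cup\dots\cup F_{i-1}$ or a bridge of $H$ with exactly one endpoint in $F_0\cup\dots\cup F_{i-1}$. $\varphi(H)$ is the minimum number of even ears (bridges not counted) in a generalized ear decomposition of $H$; $\psi(H)$ is the number of bridges of $H$. For a disconnected graph, $\varphi$ and $\psi$ are the sums over the connected components. For $G=G_1\cup\dots\cup G_t$ a disjoint union of $t$ connected non-bipartite graphs, $\nu^*(G)=\frac12\big(\mathrm{card}(G)+\varphi(G)+\psi(G)-t\big)$, where $\mathrm{card}(G)$ is the number of vertices of $G$. *)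

theory Defs
  imports Complex_Main
begin

section \<open>Finite simple graphs\<close>

datatype 'a ugraph = Graph (verts: "'a set") (edges: "'a set set")

definition simple_graph :: "'a ugraph \<Rightarrow> bool" where
  "simple_graph G \<longleftrightarrow> finite (verts G) \<and> (\<forall>e \<in> edges G. e \<subseteq> verts G \<and> card e = 2)"

definition graph_Union :: "'a ugraph set \<Rightarrow> 'a ugraph" where
  "graph_Union \<F> = Graph (\<Union>F\<in>\<F>. verts F) (\<Union>F\<in>\<F>. edges F)"

definition induced :: "'a ugraph \<Rightarrow> 'a set \<Rightarrow> 'a ugraph" where
  "induced G X = Graph (verts G \<inter> X) {e \<in> edges G. e \<subseteq> X}"

definition delete_vertex :: "'a ugraph \<Rightarrow> 'a \<Rightarrow> 'a ugraph" where
  "delete_vertex G v = induced G (verts G - {v})"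

definition delete_edge :: "'a ugraph \<Rightarrow> 'a set \<Rightarrow> 'a ugraph" where
  "delete_edge G e = Graph (verts G) (edges G - {e})"

definition disjoint_union_of :: "nat \<Rightarrow> (nat \<Rightarrow> 'a ugraph) \<Rightarrow> 'a ugraph \<Rightarrow> bool" where
  "disjoint_union_of t H G \<longleftrightarrow>
     (\<forall>i \<in> {1..t}. \<forall>j \<in> {1..t}. i \<noteq> j \<longrightarrow> verts (H i) \<inter> verts (H j) = {}) \<and>
     G = graph_Union (H ` {1..t})"

definition reachable :: "'a ugraph \<Rightarrow> 'a \<Rightarrow> 'a \<Rightarrow> bool" where
  "reachable G u v \<longleftrightarrow> (u, v) \<in> {(x, y). {x, y} \<in> edges G}\<^sup>*"

definition connected_graph :: "'a ugraph \<Rightarrow> bool" where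
  "connected_graph G \<longleftrightarrow> verts G \<noteq> {} \<and> (\<forall>u \<in> verts G. \<forall>v \<in> verts G. reachable G u v)"

definition components :: "'a ugraph \<Rightarrow> 'a ugraph set" where
  "components G = (\<lambda>u. induced G {v \<in> verts G. reachable G u v}) ` verts G"

definition bipartite :: "'a ugraph \<Rightarrow> bool" where
  "bipartite G \<longleftrightarrow>
     (\<exists>X Y. X \<union> Y = verts G \<and> X \<inter> Y = {} \<and> (\<forall>e \<in> edges G. e \<inter> X \<noteq> {} \<and> e \<inter> Y \<noteq> {}))"

section \<open>Matchings\<close>

definition matching :: "'a ugraph \<Rightarrow> 'a set set \<Rightarrow> bool" where
  "matching G M \<longleftrightarrow> M \<subseteq> edges G \<and> (\<forall>e \<in> M. \<forall>f \<in> M. e \<noteq> f \<longrightarrow> e \<inter> f = {})"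

definition perfect_matching :: "'a ugraph \<Rightarrow> 'a set set \<Rightarrow> bool" where
  "perfect_matching G M \<longleftrightarrow> matching G M \<and> \<Union>M = verts G"

definition matching_number :: "'a ugraph \<Rightarrow> nat" where
  "matching_number G = Max {card M | M. matching G M}"

definition factor_critical :: "'a ugraph \<Rightarrow> bool" where
  "factor_critical G \<longleftrightarrow> (\<forall>v \<in> verts G. \<exists>M. perfect_matching (delete_vertex G v) M)"

definition matching_critical :: "'a ugraph \<Rightarrow> bool" where
  "matching_critical G \<longleftrightarrow>
     (\<exists>t H. disjoint_union_of t H G \<and> (\<forall>i \<in> {1..t}. simple_graph (H i) \<and> factor_critical (H i)))"

section \<open>Replication\<close>

text \<open>The pair \<open>(v, l)\<close> is the \<open>l\<close>-th copy of the vertex \<open>v\<close>.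
  Only the values of \<open>b\<close> on the vertices of \<open>G\<close> matter.\<close>

definition replication :: "('a \<Rightarrow> nat) \<Rightarrow> 'a ugraph \<Rightarrow> ('a \<times> nat) ugraph" where
  "replication b G =
     Graph (SIGMA v:verts G. {1..b v})
       {{(u, l), (v, m)} | u l v m. {u, v} \<in> edges G \<and> l \<in> {1..b u} \<and> m \<in> {1..b v}}"

section \<open>Ears, bridges and generalized ear decompositions\<close>

definition walk_graph :: "'a list \<Rightarrow> 'a ugraph" where
  "walk_graph xs = Graph (set xs) {{xs ! i, xs ! Suc i} | i. Suc i < length xs}"

definition path_between :: "'a \<Rightarrow> 'a \<Rightarrow> 'a ugraph \<Rightarrow> bool" where
  "path_between a b F \<longleftrightarrow>
     (\<exists>xs. distinct xs \<and> xs \<noteq> [] \<and> hd xs = a \<and> last xs = b \<and> F = walk_graph xs)"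

definition cycle_through :: "'a \<Rightarrow> 'a ugraph \<Rightarrow> bool" where
  "cycle_through a F \<longleftrightarrow>
     (\<exists>xs. distinct xs \<and> length xs \<ge> 3 \<and> hd xs = a \<and> F = walk_graph (xs @ [a]))"

definition is_cycle :: "'a ugraph \<Rightarrow> bool" where
  "is_cycle F \<longleftrightarrow> (\<exists>a. cycle_through a F)"

text \<open>Disjointness of the edge sets only matters for an ear consisting of a single edge: it must be
  an edge that is not yet present.\<close>

definition ear_of :: "'a ugraph \<Rightarrow> 'a ugraph \<Rightarrow> bool" where
  "ear_of K F \<longleftrightarrow>
     (\<exists>a \<in> verts K. \<exists>b \<in> verts K.
        (if a = b then cycle_through a F else path_between a b F) \<and>
        verts F \<inter> verts K = {a, b} \<and> edges F \<inter> edges K = {})"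

definition bridges :: "'a ugraph \<Rightarrow> 'a set set" where
  "bridges H = {e \<in> edges H. \<exists>u v. e = {u, v} \<and> \<not> reachable (delete_edge H e) u v}"

definition bridge_subgraph :: "'a ugraph \<Rightarrow> 'a ugraph \<Rightarrow> bool" where
  "bridge_subgraph H F \<longleftrightarrow> (\<exists>e \<in> bridges H. F = Graph e {e})"

definition generalized_ear_decomposition :: "'a ugraph \<Rightarrow> 'a ugraph list \<Rightarrow> bool" where
  "generalized_ear_decomposition H Fs \<longleftrightarrow>
     Fs \<noteq> [] \<and> graph_Union (set Fs) = H \<and>
     (is_cycle (Fs ! 0) \<or> bridge_subgraph H (Fs ! 0)) \<and>
     (\<forall>i. 1 \<le> i \<and> i < length Fs \<longrightarrow>
        ear_of (graph_Union (set (take i Fs))) (Fs ! i) \<or>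
        bridge_subgraph H (Fs ! i) \<and>
          card (verts (Fs ! i) \<inter> verts (graph_Union (set (take i Fs)))) = 1)"

definition even_ears :: "'a ugraph \<Rightarrow> 'a ugraph list \<Rightarrow> nat" where
  "even_ears H Fs =
     card {i. i < length Fs \<and> \<not> bridge_subgraph H (Fs ! i) \<and> even (card (edges (Fs ! i)))}"

text \<open>A single vertex has no generalized ear decomposition, so \<open>\<phi>\<close> is meaningful only for graphs
  without isolated vertices; in particular for graphs all of whose components are non-bipartite.\<close>

definition phi_connected :: "'a ugraph \<Rightarrow> nat" where
  "phi_connected H = (LEAST n. \<exists>Fs. generalized_ear_decomposition H Fs \<and> even_ears H Fs = n)"

definition phi :: "'a ugraph \<Rightarrow> nat" where
  "phi G = (\<Sum>H \<in> components G. phi_connected H)"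

definition psi :: "'a ugraph \<Rightarrow> nat" where
  "psi G = (\<Sum>H \<in> components G. card (bridges H))"

definition nu_star :: "'a ugraph \<Rightarrow> real" where
  "nu_star G =
     (real (card (verts G)) + real (phi G) + real (psi G) - real (card (components G))) / 2"

section \<open>Attained minima\<close>

definition is_minimum :: "'b::order \<Rightarrow> 'b set \<Rightarrow> bool" where
  "is_minimum m S \<longleftrightarrow> m \<in> S \<and> (\<forall>x \<in> S. m \<le> x)"

end

theory Submission
  imports Defs
begin

text \<open>Relax generalized ear decompositions by allowing, at unit cost, any pendant edge \<open>{a, z}\<close>, viewed
  as the closed even ear \<open>a, z, a\<close>. Such a build of a connected graph can be restarted from some path
  between any two prescribed vertices at no loss, and this exchange has two consequences. A
  pendant edge that is later covered by an ear can be absorbed into that ear, so a cheapest build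
  with fewest pendant edges has exactly the bridges as pendant edges and is a generalized ear
  decomposition: the least cost is \<open>\<phi> + \<psi>\<close>. And a non-bipartite graph can be built from an odd cycle,
  after which each even ear is made odd by one additional copy of its end vertex, so \<open>\<phi> + \<psi>\<close> extra
  copies yield a factor-critical replication. Conversely, a factor-critical replication grows by odd
  alternating ears; each projects to a walk in the graph, and the number of repeated
  vertices on that walk pays for the even ears it decomposes into.\<close>

section \<open>Walks, builds and the exchange along a path\<close>

text \<open>The obstacle is that \<open>phi\<close> leaves only bridges uncounted, while the
  decomposition read off from a replication can leave pendant edges wherever a projected walk turns
  back. Charging every pendant edge makes both comparable, at the price of showing that a charged
  non-bridge can be traded away. An ear with inner vertices \<open>zs\<close> has
  \<open>length zs + 1\<close> edges, so \<open>length zs mod 2\<close> is 1 precisely for an even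
  ear. The exchange must book parity as well: a path with oddly many edges has to save one unit in
  the remaining build. Without this credit the induction would not close, because a detour through
  the last ear changes the parity both of the path and of what remains of the ear. The formula for
  the matching number follows from the one for |a|: a factor-critical graph on n vertices has
  matching number (n - 1)/2, so with t components twice the matching number plus t equals card(G) +
  |a|, and the same vectors attain both minima. Replication commutes with disjoint union, which
  separates the problem into components.\<close>

fun walk_edges :: "'a list \<Rightarrow> 'a set list" where
  "walk_edges (x # y # xs) = {x, y} # walk_edges (y # xs)"
| "walk_edges _ = []"

abbreviation wE :: "'a list \<Rightarrow> 'a set set" where
  "wE xs \<equiv> set (walk_edges xs)"

lemma walk_edges_Cons: "xs \<noteq> [] \<Longrightarrow> walk_edges (x # xs) = {x, hd xs} # walk_edges xs"
  by (cases xs) auto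

lemma walk_edges_append:
  "xs \<noteq> [] \<Longrightarrow> ys \<noteq> [] \<Longrightarrow>
    walk_edges (xs @ ys) = walk_edges xs @ {last xs, hd ys} # walk_edges ys"
  by (induction xs) (auto simp: walk_edges_Cons)

lemma wE_append:
  "xs \<noteq> [] \<Longrightarrow> ys \<noteq> [] \<Longrightarrow> wE (xs @ ys) = wE xs \<union> {{last xs, hd ys}} \<union> wE ys"
  by (simp add: walk_edges_append)

lemma wE_rev: "wE (rev xs) = wE xs"
proof (induction xs)
  case (Cons x xs)
  show ?case
  proof (cases "xs = []")
    case False
    then have "wE (rev xs @ [x]) = wE (rev xs) \<union> {{hd xs, x}}"
      by (subst wE_append) (auto simp: last_rev)
    then show ?thesis using Cons False by (simp add: walk_edges_Cons insert_commute)
  qed auto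
qed auto

lemma length_walk_edges: "length (walk_edges xs) = length xs - 1"
  by (induction xs rule: walk_edges.induct) auto

lemma wE_subset: "wE xs \<subseteq> Pow (set xs)"
  by (induction xs rule: walk_edges.induct) auto

lemma walk_graph_eq: "walk_graph xs = Graph (set xs) (wE xs)"
proof -
  have "{{xs ! i, xs ! Suc i} | i. Suc i < length xs} = wE xs"
  proof (induction xs rule: walk_edges.induct)
    case (1 x y xs)
    have "{{(x # y # xs) ! i, (x # y # xs) ! Suc i} | i. Suc i < length (x # y # xs)} =
      insert {x, y} {{(y # xs) ! i, (y # xs) ! Suc i} | i. Suc i < length (y # xs)}"
      (is "?A = insert _ ?B")
    proof (intro equalityI subsetI)
      fix e assume "e \<in> ?A"
      then obtain i where "e = {(x # y # xs) ! i, (x # y # xs) ! Suc i}"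
        "Suc i < length (x # y # xs)" by blast
      then show "e \<in> insert {x, y} ?B" by (cases i) auto
    next
      fix e assume e: "e \<in> insert {x, y} ?B"
      show "e \<in> ?A"
      proof (cases "e = {x, y}")
        case True
        then show ?thesis by (auto intro!: exI[of _ 0])
      next
        case False
        then obtain i where "e = {(y # xs) ! i, (y # xs) ! Suc i}" "Suc i < length (y # xs)"
          using e by blast
        then show ?thesis by (auto intro!: exI[of _ "Suc i"])
      qed
    qed
    then show ?case using 1 by simp
  qed auto
  then show ?thesis unfolding walk_graph_def by simp
qed

lemma wE_ear_split:
  "wE (a # (us @ y # vs) @ [b]) = wE (a # us @ [y]) \<union> wE (y # vs @ [b])"
proof -
  have "wE ((a # us) @ (y # vs @ [b])) = wE (a # us) \<union> {{last (a # us), y}} \<union> wE (y # vs @ [b])"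
    by (subst wE_append) auto
  moreover have "wE ((a # us) @ [y]) = wE (a # us) \<union> {{last (a # us), y}}"
    by (subst wE_append) auto
  ultimately show ?thesis by simp
qed

lemma wE_ear_rev: "wE (b # rev zs @ [a]) = wE (a # zs @ [b])"
  using wE_rev[of "a # zs @ [b]"] by simp

text \<open>Describes a walk rerouted through a path \<open>ps\<close>. The ends of
  \<open>ps\<close> are shared with the neighbouring pieces, so an empty \<open>us\<close> or
  \<open>vs\<close> contributes a one-vertex walk without edges.\<close>

lemma wE_join:
  assumes "ps \<noteq> []"
  shows "wE (us @ ps @ vs) = wE (us @ [hd ps]) \<union> wE ps \<union> wE (last ps # vs)"
proof -
  have 1: "wE (ps @ vs) = wE ps \<union> wE (last ps # vs)"
    using assms by (cases "vs = []") (auto simp: wE_append walk_edges_Cons)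
  show ?thesis
  proof (cases "us = []")
    case False
    then show ?thesis using assms 1
      by (auto simp: wE_append hd_append)
  qed (use 1 in auto)
qed

lemma distinct_walk_edges: "distinct xs \<Longrightarrow> distinct (walk_edges xs)"
proof (induction xs rule: walk_edges.induct)
  case (1 x y xs)
  then have "{x, y} \<notin> wE (y # xs)" using wE_subset[of "y # xs"] by auto
  then show ?case using 1 by auto
qed auto

text \<open>The closed ear \<open>a, z, a\<close> is the only ear whose walk traverses an edge
  twice. Its edge is returned as a set with at most one element, to be united with the pendant edges
  found before.\<close>

definition pendant_edges :: "'a \<Rightarrow> 'a list \<Rightarrow> 'a \<Rightarrow> 'a set set" where
  "pendant_edges a zs b = (if a = b \<and> length zs = 1 then {{a, hd zs}} else {})"

text \<open>Only a closed ear can repeat an edge, and then its last edge \<open>{last zs, a}\<close>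
  must be its first edge \<open>{a, z}\<close>; this forces a single inner vertex, the excluded
  pendant case.\<close>

lemma distinct_walk_edges_ear:
  assumes "distinct zs" "a \<notin> set zs" "b \<notin> set zs" "zs = [] \<Longrightarrow> a \<noteq> b"
    and "pendant_edges a zs b = {}"
  shows "distinct (walk_edges (a # zs @ [b]))"
proof (cases "a = b")
  case False
  then show ?thesis using assms by (intro distinct_walk_edges) auto
next
  case True
  then obtain z ws where zs: "zs = z # ws" "ws \<noteq> []"
    using assms by (cases zs) (auto simp: pendant_edges_def split: if_splits)
  have eq: "walk_edges (a # zs @ [b]) = walk_edges (a # zs) @ [{last zs, a}]"
    using walk_edges_append[of "a # zs" "[b]"] True zs by simp
  have "last zs \<noteq> z" using assms(1) zs by auto
  have "wE zs \<subseteq> Pow (set zs)" by (rule wE_subset)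
  then have "{last zs, a} \<notin> wE zs" using assms(2) by auto
  moreover have "{last zs, a} \<noteq> {a, z}" using \<open>last zs \<noteq> z\<close> assms(2) zs
    by (metis doubleton_eq_iff)
  ultimately have "{last zs, a} \<notin> wE (a # zs)" using zs by (simp add: walk_edges_Cons)
  moreover have "distinct (walk_edges (a # zs))" using assms by (intro distinct_walk_edges) auto
  ultimately show ?thesis unfolding eq by simp
qed

section \<open>Builds and their composition\<close>

text \<open>The list \<open>zs\<close> consists of the inner vertices of an ear, so \<open>c\<close> counts the even ears, including
  the pendant edges, which are collected in \<open>D\<close>. An ear without inner vertices may repeat an edge.\<close>

inductive builds ::
  "'a set \<Rightarrow> 'a set set \<Rightarrow> nat \<Rightarrow> 'a set set \<Rightarrow> 'a set \<Rightarrow> 'a set set \<Rightarrow> bool" for V0 E0 where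
  start: "builds V0 E0 0 {} V0 E0"
| ear: "builds V0 E0 c D V E \<Longrightarrow> a \<in> V \<Longrightarrow> b \<in> V \<Longrightarrow> distinct zs \<Longrightarrow> set zs \<inter> V = {} \<Longrightarrow>
    (zs = [] \<Longrightarrow> a \<noteq> b) \<Longrightarrow>
    builds V0 E0 (c + length zs mod 2) (D \<union> pendant_edges a zs b)
      (V \<union> set zs) (E \<union> wE (a # zs @ [b]))"

lemma builds_mono: "builds V0 E0 c D V E \<Longrightarrow> V0 \<subseteq> V \<and> E0 \<subseteq> E"
  by (induction rule: builds.induct) auto

lemma builds_edges_within:
  "builds V0 E0 c D V E \<Longrightarrow> E0 \<subseteq> Pow V0 \<Longrightarrow> E \<subseteq> Pow V"
proof (induction rule: builds.induct)
  case (ear c D V E a b zs)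
  then show ?case using wE_subset[of "a # zs @ [b]"] by auto
qed auto

lemma builds_pendants: "builds V0 E0 c D V E \<Longrightarrow> D \<subseteq> E"
proof (induction rule: builds.induct)
  case (ear c D V E a b zs)
  have "pendant_edges a zs b \<subseteq> wE (a # zs @ [b])"
    by (cases zs) (auto simp: pendant_edges_def)
  then show ?case using ear by blast
qed auto

lemma builds_pendants_finite: "builds V0 E0 c D V E \<Longrightarrow> finite D"
  by (induction rule: builds.induct) (auto simp: pendant_edges_def)

lemma builds_finite: "builds V0 E0 c D V E \<Longrightarrow> finite V0 \<Longrightarrow> finite V"
  by (induction rule: builds.induct) auto

lemma builds_ear:
  assumes "builds V0 E0 c D V E" "a \<in> V" "b \<in> V" "distinct zs" "set zs \<inter> V = {}"
    "zs = [] \<Longrightarrow> a \<noteq> b" "V' = V \<union> set zs" "E' = E \<union> wE (a # zs @ [b])"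
    "c' = c + length zs mod 2" "D' = D \<union> pendant_edges a zs b"
  shows "builds V0 E0 c' D' V' E'"
  using ear[OF assms(1-6)] assms(7-) by simp

lemma builds_trans:
  assumes "builds V1 E1 c2 D2 V2 E2" "builds V0 E0 c1 D1 V1 E1"
  shows "builds V0 E0 (c1 + c2) (D1 \<union> D2) V2 E2"
  using assms
proof (induction rule: builds.induct)
  case (ear c D V E a b zs)
  have "builds V0 E0 (c1 + c) (D1 \<union> D) V E" by (rule ear.IH[OF ear.prems])
  from builds.ear[OF this ear.hyps(2-6)] show ?case by (simp only: ac_simps)
qed auto

text \<open>Every ear stays an ear over the larger start, because the vertices of \<open>V1\<close>
  outside \<open>V0\<close> never occur among its new vertices. This allows another ear to be placed
  before a complete build.\<close>

lemma builds_extend: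
  assumes "builds V0 E0 c D V E" "V0 \<subseteq> V1" "E0 \<subseteq> E1" "V1 \<inter> V \<subseteq> V0"
  shows "builds V1 E1 c D (V \<union> V1) (E \<union> E1)"
  using assms
proof (induction rule: builds.induct)
  case start
  then have "V0 \<union> V1 = V1" "E0 \<union> E1 = E1" by auto
  then show ?case by (simp add: builds.start)
next
  case (ear c D V E a b zs)
  moreover have "set zs \<inter> (V \<union> V1) = {}"
    using ear.prems ear.hyps(5) builds_mono[OF ear.hyps(1)] by auto
  moreover have "builds V1 E1 c D (V \<union> V1) (E \<union> E1)"
    by (rule ear.IH) (use ear.prems in auto)
  ultimately show ?case by (elim builds_ear[of V1 E1 c D "V \<union> V1" "E \<union> E1" a b zs]) auto
qed

section \<open>Restarting a build from a path\<close>

text \<open>The excess \<open>(length ps + 1) mod 2\<close> is 1 precisely if the path \<open>ps\<close> has an odd number of edges.\<close>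

definition path_build :: "'a \<Rightarrow> 'a \<Rightarrow> nat \<Rightarrow> 'a set set \<Rightarrow> 'a set \<Rightarrow> 'a set set \<Rightarrow> bool" where
  "path_build y b c D V E \<longleftrightarrow> (\<exists>ps c' D'. ps \<noteq> [] \<and> hd ps = y \<and> last ps = b \<and> distinct ps \<and>
     builds (set ps) (wE ps) c' D' V E \<and> D' \<subseteq> D \<and> c' + (length ps + 1) mod 2 \<le> c)"

lemma path_buildE:
  assumes "path_build y b c D V E"
  obtains ps c' D' where "ps \<noteq> []" "hd ps = y" "last ps = b" "distinct ps"
    "builds (set ps) (wE ps) c' D' V E" "D' \<subseteq> D" "c' + (length ps + 1) mod 2 \<le> c"
  using assms unfolding path_build_def by blast

lemma path_buildI:
  assumes "builds (set ps) (wE ps) c' D' V E" "ps \<noteq> []" "hd ps = y" "last ps = b" "distinct ps"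
    "D' \<subseteq> D" "c' + (length ps + 1) mod 2 \<le> c"
  shows "path_build y b c D V E"
  using assms unfolding path_build_def by blast

lemma path_build_sym: "path_build y b c D V E \<Longrightarrow> path_build b y c D V E"
  by (elim path_buildE, rule path_buildI[of "rev _"]) (auto simp: wE_rev hd_rev last_rev)

text \<open>The path runs from \<open>y\<close> back along \<open>us\<close> to \<open>a\<close> and
  on through the old graph to \<open>b\<close>; the rest \<open>vs\<close> becomes an ear from
  \<open>y\<close> to \<open>e\<close>. This is affordable unless \<open>us\<close> has even and
  \<open>vs\<close> odd length, and then the reversed ear qualifies. Since \<open>y\<close> is new
  and \<open>e\<close> is old, the remaining ear is never pendant and \<open>D\<close> does not
  grow.\<close>

lemma path_build_ear_outer:
  assumes "path_build a b c D V E" "e \<in> V" "distinct (us @ y # vs)"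
    "set (us @ y # vs) \<inter> V = {}" "even (length vs) \<or> odd (length us)"
  shows "path_build y b (c + length (us @ y # vs) mod 2) D (V \<union> set (us @ y # vs))
           (E \<union> wE (a # (us @ y # vs) @ [e]))"
  using assms(1)
proof (rule path_buildE)
  fix ps c' D'
  assume ps: "ps \<noteq> []" "hd ps = a" "last ps = b" "distinct ps" "builds (set ps) (wE ps) c' D' V E"
    and D': "D' \<subseteq> D" and c': "c' + (length ps + 1) mod 2 \<le> c"
  define qs where "qs = y # rev us @ ps"
  have sub: "set ps \<subseteq> V" "wE ps \<subseteq> E" using builds_mono[OF ps(5)] by auto
  have qsE: "wE qs = wE (a # us @ [y]) \<union> wE ps"
    using wE_join[of ps "y # rev us" "[]"] ps wE_ear_rev[of y us a] by (simp add: qs_def)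
  have 1: "builds (set qs) (wE qs) c' D' (V \<union> set qs) (E \<union> wE qs)"
  proof (rule builds_extend[OF ps(5)])
    show "wE ps \<subseteq> wE qs" by (simp add: qsE)
  qed (use assms(4) in \<open>auto simp: qs_def\<close>)
  have 2: "builds (set qs) (wE qs) (c' + length vs mod 2) D' (V \<union> set (us @ y # vs))
           (E \<union> wE (a # (us @ y # vs) @ [e]))"
  proof (rule builds_ear[OF 1])
    show "E \<union> wE (a # (us @ y # vs) @ [e]) = E \<union> wE qs \<union> wE (y # vs @ [e])"
      unfolding qsE wE_ear_split using sub by auto
    show "D' = D' \<union> pendant_edges y vs e" using assms(2,4) by (auto simp: pendant_edges_def)
    show "set vs \<inter> (V \<union> set qs) = {}" using assms(3,4) sub by (auto simp: qs_def)
  qed (use assms(2,3,4) sub in \<open>auto simp: qs_def\<close>)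
  show ?thesis
  proof (rule path_buildI[OF 2])
    have "length qs = length us + length ps + 1" by (simp add: qs_def)
    then show "c' + length vs mod 2 + (length qs + 1) mod 2 \<le> c + length (us @ y # vs) mod 2"
      using c' assms(5) by (auto simp: mod_2_eq_odd of_bool_def split: if_splits)
    show "distinct qs" using assms(3,4) ps(4) sub by (auto simp: qs_def)
  qed (use ps D' in \<open>auto simp: qs_def\<close>)
qed

text \<open>Two routes join \<open>y\<close> to \<open>b\<close>: \<open>ms\<close> along the ear,
  or \<open>us\<close>, the old path and \<open>vs\<close> around it. One becomes the path and the
  other an ear closing it; parity decides which.\<close>

lemma path_build_ear_inner:
  assumes "path_build a e c D V E" "distinct (us @ y # ms @ b # vs)"
    "set (us @ y # ms @ b # vs) \<inter> V = {}"
  shows "path_build y b (c + length (us @ y # ms @ b # vs) mod 2) D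
           (V \<union> set (us @ y # ms @ b # vs)) (E \<union> wE (a # (us @ y # ms @ b # vs) @ [e]))"
    (is "path_build y b ?c D ?V ?E")
  using assms(1)
proof (rule path_buildE)
  fix ps c' D'
  assume ps: "ps \<noteq> []" "hd ps = a" "last ps = e" "distinct ps" "builds (set ps) (wE ps) c' D' V E"
    and D': "D' \<subseteq> D" and c': "c' + (length ps + 1) mod 2 \<le> c"
  have sub: "set ps \<subseteq> V" "wE ps \<subseteq> E" using builds_mono[OF ps(5)] by auto
  define zs where "zs = rev us @ ps @ rev vs"
  have zsE: "wE (y # zs @ [b]) = wE (a # us @ [y]) \<union> wE ps \<union> wE (b # vs @ [e])"
    using wE_join[of ps "y # rev us" "rev vs @ [b]"] ps wE_ear_rev[of y us a] wE_ear_rev[of e vs b]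
    by (simp add: zs_def)
  have E: "?E = E \<union> wE (y # ms @ [b]) \<union> wE (y # zs @ [b])"
    using sub wE_ear_split[of a us y "ms @ b # vs" e] wE_ear_split[of y ms b vs e]
    unfolding zsE by auto
  show ?thesis
  \<comment> \<open>The inner route is too dear only if it has oddly many edges, the outer ear has
    oddly many inner vertices and the old path yields no credit. In that case the outer route has
    evenly many edges and \<open>ms\<close> gives an odd ear, so neither costs anything.\<close>
  proof (cases "odd (length ms) \<or> even (length ps) \<or> odd (length us + length vs)")
    case True
    have 1: "builds (set (y # ms @ [b])) (wE (y # ms @ [b])) (length zs mod 2) {}
       (set (y # ms @ [b]) \<union> set zs) (wE (y # ms @ [b]) \<union> wE (y # zs @ [b]))"
      by (rule builds_ear[OF builds.start, of y _ b zs])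
        (use assms ps(1,4) sub in \<open>auto simp: zs_def pendant_edges_def\<close>)
    have 2: "builds (set (y # ms @ [b]) \<union> set zs) (wE (y # ms @ [b]) \<union> wE (y # zs @ [b])) c' D'
       (V \<union> (set (y # ms @ [b]) \<union> set zs)) (E \<union> (wE (y # ms @ [b]) \<union> wE (y # zs @ [b])))"
    proof (rule builds_extend[OF ps(5)])
      show "wE ps \<subseteq> wE (y # ms @ [b]) \<union> wE (y # zs @ [b])" unfolding zsE by blast
    qed (use assms sub in \<open>auto simp: zs_def\<close>)
    have 3: "builds (set (y # ms @ [b])) (wE (y # ms @ [b])) (length zs mod 2 + c') D' ?V ?E"
    proof -
      have "V \<union> (set (y # ms @ [b]) \<union> set zs) = ?V" using sub by (auto simp: zs_def)
      moreover have "E \<union> (wE (y # ms @ [b]) \<union> wE (y # zs @ [b])) = ?E" using E by auto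
      ultimately show ?thesis using builds_trans[OF 2 1] by simp
    qed
    show ?thesis
    proof (rule path_buildI[OF 3])
      have "length zs = length us + length ps + length vs" by (simp add: zs_def)
      then show "length zs mod 2 + c' + (length (y # ms @ [b]) + 1) mod 2 \<le> ?c"
        using c' True by (auto simp: mod_2_eq_odd of_bool_def split: if_splits)
    qed (use assms D' in auto)
  next
    case False
    define qs where "qs = y # zs @ [b]"
    have 1: "builds (set qs) (wE qs) c' D' (V \<union> set qs) (E \<union> wE qs)"
    proof (rule builds_extend[OF ps(5)])
      show "wE ps \<subseteq> wE qs" unfolding qs_def zsE by blast
    qed (use assms in \<open>auto simp: zs_def qs_def\<close>)
    have 2: "builds (set qs) (wE qs) (c' + length ms mod 2) D' ?V ?E"
      by (rule builds_ear[OF 1, of y b ms])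
        (use assms E sub in \<open>auto simp: zs_def qs_def pendant_edges_def\<close>)
    show ?thesis
    proof (rule path_buildI[OF 2])
      have "length qs = length us + length ps + length vs + 2" by (simp add: qs_def zs_def)
      then show "c' + length ms mod 2 + (length qs + 1) mod 2 \<le> ?c"
        using c' False by (auto simp: mod_2_eq_odd of_bool_def split: if_splits)
    qed (use assms D' ps(4) sub in \<open>auto simp: qs_def zs_def\<close>)
  qed
qed

text \<open>The path is the single vertex \<open>y\<close>, with excess 0, and the old path together
  with both halves of the ear forms a closed ear at \<open>y\<close>. It is pendant only if
  \<open>us\<close> and \<open>vs\<close> are empty and \<open>ps = [a]\<close>, and then the given
  ear was already the pendant edge \<open>{a, y}\<close>.\<close>

lemma path_build_ear_same:
  assumes "path_build a e c D V E" "distinct (us @ y # vs)" "set (us @ y # vs) \<inter> V = {}"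
  shows "path_build y y (c + length (us @ y # vs) mod 2) (D \<union> pendant_edges a (us @ y # vs) e)
           (V \<union> set (us @ y # vs)) (E \<union> wE (a # (us @ y # vs) @ [e]))"
    (is "path_build y y ?c ?D ?V ?E")
  using assms(1)
proof (rule path_buildE)
  fix ps c' D'
  assume ps: "ps \<noteq> []" "hd ps = a" "last ps = e" "distinct ps" "builds (set ps) (wE ps) c' D' V E"
    and D': "D' \<subseteq> D" and c': "c' + (length ps + 1) mod 2 \<le> c"
  have sub: "set ps \<subseteq> V" "wE ps \<subseteq> E" using builds_mono[OF ps(5)] by auto
  define zs where "zs = rev us @ ps @ rev vs"
  have zsE: "wE (y # zs @ [y]) = wE (a # us @ [y]) \<union> wE ps \<union> wE (y # vs @ [e])"
    using wE_join[of ps "y # rev us" "rev vs @ [y]"] ps wE_ear_rev[of y us a] wE_ear_rev[of e vs y]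
    by (simp add: zs_def)
  have 1: "builds {y} {} (length zs mod 2) (pendant_edges y zs y)
       ({y} \<union> set zs) (wE (y # zs @ [y]))"
    by (rule builds_ear[OF builds.start, of y _ y zs])
      (use assms ps(1,4) sub in \<open>auto simp: zs_def\<close>)
  have 2: "builds ({y} \<union> set zs) (wE (y # zs @ [y])) c' D'
       (V \<union> ({y} \<union> set zs)) (E \<union> wE (y # zs @ [y]))"
  proof (rule builds_extend[OF ps(5)])
    show "wE ps \<subseteq> wE (y # zs @ [y])" unfolding zsE by blast
  qed (use assms sub in \<open>auto simp: zs_def\<close>)
  have 3: "builds (set [y]) (wE [y]) (length zs mod 2 + c') (pendant_edges y zs y \<union> D') ?V ?E"
  proof -
    have "V \<union> ({y} \<union> set zs) = ?V" using sub by (auto simp: zs_def)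
    moreover have "E \<union> wE (y # zs @ [y]) = ?E" using sub wE_ear_split[of a us y vs e] zsE by auto
    ultimately show ?thesis using builds_trans[OF 2 1] by simp
  qed
  show ?thesis
  proof (rule path_buildI[OF 3])
    have "length zs = length us + length ps + length vs" by (simp add: zs_def)
    then show "length zs mod 2 + c' + (length [y] + 1) mod 2 \<le> ?c"
      using c' by (auto simp: mod_2_eq_odd of_bool_def split: if_splits)
    have "pendant_edges y zs y \<subseteq> pendant_edges a (us @ y # vs) e"
    proof (cases "length zs = 1")
      case True
      then have "length us + length ps + length vs = 1" by (simp add: zs_def)
      moreover have "length ps > 0" using ps(1) by simp
      ultimately have "length us = 0" "length vs = 0" "length ps = 1" by linarith+
      then have "us = []" "vs = []" "ps = [a]" "e = a"
        using ps(2,3) by (auto simp: length_Suc_conv)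
      then show ?thesis by (auto simp: zs_def pendant_edges_def)
    qed (auto simp: pendant_edges_def)
    then show "pendant_edges y zs y \<union> D' \<subseteq> ?D" using D' by auto
  qed auto
qed

lemma path_build_weaken:
  "path_build y b c D V E \<Longrightarrow> D \<subseteq> D1 \<Longrightarrow> path_build y b c D1 V E"
  unfolding path_build_def by blast

lemma path_build_rev_ear:
  assumes "path_build y b (c + length (rev zs) mod 2) D (V \<union> set (rev zs)) (E \<union> wE (e # rev zs @ [a]))"
  shows "path_build y b (c + length zs mod 2) D (V \<union> set zs) (E \<union> wE (a # zs @ [e]))"
  using assms by (simp add: wE_ear_rev del: walk_edges.simps)

text \<open>Induction on the last ear, split by how many of \<open>y\<close> and \<open>b\<close>
  are inner vertices of it; two old vertices keep their path and the ear is appended. The case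
  \<open>y = b\<close> shows that any vertex can replace the root at no greater cost.\<close>

theorem builds_along_path:
  assumes "builds {r} {} c D V E" "y \<in> V" "b \<in> V"
  shows "path_build y b c D V E"
  using assms
proof (induction arbitrary: y b rule: builds.induct)
  case start
  then have "y = r" "b = r" by auto
  moreover have "builds (set [r]) (wE [r]) 0 {} {r} {}" using builds.start by simp
  ultimately show ?case by (intro path_buildI[of "[r]" 0 "{}"]) auto
next
  case (ear c D V E a e zs)
  have outer: "path_build y b (c + length zs mod 2) (D \<union> pendant_edges a zs e)
      (V \<union> set zs) (E \<union> wE (a # zs @ [e]))" if yb: "y \<in> set zs" "b \<in> V" for y b
  proof -
    obtain us vs where zs: "zs = us @ y # vs" using yb(1) by (meson split_list)
    have "path_build y b (c + length zs mod 2) D (V \<union> set zs) (E \<union> wE (a # zs @ [e]))"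
    proof (cases "even (length vs) \<or> odd (length us)")
      case True
      show ?thesis unfolding zs
        by (rule path_build_ear_outer) (use ear yb True zs in auto)
    next
      case False
      have "path_build y b (c + length (rev vs @ y # rev us) mod 2) D
        (V \<union> set (rev vs @ y # rev us)) (E \<union> wE (e # (rev vs @ y # rev us) @ [a]))"
        by (rule path_build_ear_outer) (use ear yb False zs in auto)
      moreover have "rev vs @ y # rev us = rev zs" using zs by simp
      ultimately show ?thesis using path_build_rev_ear by metis
    qed
    then show ?thesis by (rule path_build_weaken) auto
  qed
  consider "y \<in> V" "b \<in> V" | "y \<in> set zs" "b \<in> V" | "y \<in> V" "b \<in> set zs"
    | "y \<in> set zs" "b = y" | "y \<in> set zs" "b \<in> set zs" "y \<noteq> b"
    using ear.prems by blast
  then show ?case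
  proof cases
    case 1
    then show ?thesis
    proof (rule ear.IH[THEN path_buildE])
      fix ps c' D'
      assume ps: "ps \<noteq> []" "hd ps = y" "last ps = b" "distinct ps"
        "builds (set ps) (wE ps) c' D' V E"
        and D': "D' \<subseteq> D" and c': "c' + (length ps + 1) mod 2 \<le> c"
      show ?thesis
        by (rule path_buildI[OF builds.ear[OF ps(5) ear.hyps(2-6)]]) (use ps D' c' in auto)
    qed
  next
    case 2
    then show ?thesis by (rule outer)
  next
    case 3
    then show ?thesis by (intro path_build_sym[OF outer])
  next
    case 4
    then obtain us vs where zs: "zs = us @ y # vs" by (meson split_list)
    show ?thesis unfolding zs \<open>b = y\<close>
      by (rule path_build_ear_same) (use ear zs in auto)
  next
    case 5
    have inner: "path_build y b (c + length zs mod 2) D (V \<union> set zs) (E \<union> wE (a # zs @ [e]))"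
      if zs: "zs = us @ y # ms @ b # vs" for y b us ms vs
      unfolding zs by (rule path_build_ear_inner) (use ear zs in auto)
    obtain us vs where zs: "zs = us @ y # vs" using 5 by (meson split_list)
    have "path_build y b (c + length zs mod 2) D (V \<union> set zs) (E \<union> wE (a # zs @ [e]))"
    proof (cases "b \<in> set vs")
      case True
      then obtain ms ws where "vs = ms @ b # ws" by (meson split_list)
      then show ?thesis using zs inner by blast
    next
      case False
      then have "b \<in> set us" using 5 zs by auto
      then obtain ks ms where "us = ks @ b # ms" by (meson split_list)
      then show ?thesis using zs inner[of ks b ms y vs] path_build_sym by fastforce
    qed
    then show ?thesis by (rule path_build_weaken) auto
  qed
qed

section \<open>Absorbing pendant edges\<close>

text \<open>The edge \<open>{x, y}\<close> joins two disjoint builds rooted at its ends. The summand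
  1 is its own charge, and it is withdrawn from the pendant edges of both sides.\<close>

definition splits :: "'a \<Rightarrow> 'a \<Rightarrow> nat \<Rightarrow> 'a set set \<Rightarrow> 'a set \<Rightarrow> 'a set set \<Rightarrow> bool" where
  "splits x y c D V E \<longleftrightarrow> (\<exists>X FX cX DX Y FY cY DY. x \<in> X \<and> y \<in> Y \<and> X \<inter> Y = {} \<and> V = X \<union> Y \<and>
     E = insert {x, y} (FX \<union> FY) \<and> builds {x} {} cX DX X FX \<and> builds {y} {} cY DY Y FY \<and>
     cX + cY + 1 \<le> c \<and> DX \<union> DY \<subseteq> D - {{x, y}})"

lemma splitsI:
  assumes "builds {x} {} cX DX X FX" "builds {y} {} cY DY Y FY" "x \<in> X" "y \<in> Y" "X \<inter> Y = {}"
    "V = X \<union> Y" "E = insert {x, y} (FX \<union> FY)" "cX + cY + 1 \<le> c" "DX \<union> DY \<subseteq> D - {{x, y}}"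
  shows "splits x y c D V E"
  using assms unfolding splits_def by blast

lemma splitsE:
  assumes "splits x y c D V E"
  obtains X FX cX DX Y FY cY DY where "builds {x} {} cX DX X FX" "builds {y} {} cY DY Y FY"
    "x \<in> X" "y \<in> Y" "X \<inter> Y = {}" "V = X \<union> Y" "E = insert {x, y} (FX \<union> FY)"
    "cX + cY + 1 \<le> c" "DX \<union> DY \<subseteq> D - {{x, y}}"
  using assms unfolding splits_def by blast

lemma splits_sym:
  assumes "splits x y c D V E"
  shows "splits y x c D V E"
  using assms
proof (rule splitsE)
  fix X FX cX DX Y FY cY DY
  assume "builds {x} {} cX DX X FX" "builds {y} {} cY DY Y FY"
    and "x \<in> X" "y \<in> Y" "X \<inter> Y = {}" "V = X \<union> Y" "E = insert {x, y} (FX \<union> FY)"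
    and "cX + cY + 1 \<le> c" "DX \<union> DY \<subseteq> D - {{x, y}}"
  then show ?thesis
    by (intro splitsI[of y cY DY Y FY x cX DX X FX]) (auto simp: insert_commute)
qed

definition avoidable :: "'a set \<Rightarrow> nat \<Rightarrow> 'a set set \<Rightarrow> 'a set \<Rightarrow> 'a set set \<Rightarrow> bool" where
  "avoidable e c D V E \<longleftrightarrow> (\<exists>r c' D'. builds {r} {} c' D' V E \<and> c' \<le> c \<and> D' \<subseteq> D - {e})"

text \<open>If a new ear joins the two sides of a pendant edge \<open>{x, y}\<close>, then that edge can be made
  part of the ear: the ear is prolonged by a path in \<open>Y\<close> and by \<open>{x, y}\<close>, and \<open>Y\<close> is rebuilt
  from that path.\<close>

lemma splits_ear:
  assumes spl: "splits x y c D V E" and ab: "a \<in> V" "b \<in> V"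
    and zs: "distinct zs" "set zs \<inter> V = {}" "zs = [] \<Longrightarrow> a \<noteq> b"
  defines "c' \<equiv> c + length zs mod 2" and "D' \<equiv> D \<union> pendant_edges a zs b"
    and "V' \<equiv> V \<union> set zs" and "E' \<equiv> E \<union> wE (a # zs @ [b])"
  shows "splits x y c' D' V' E' \<or> avoidable {x, y} c' D' V' E'"
  using spl
proof (rule splitsE)
  fix X FX cX DX Y FY cY DY
  assume bX: "builds {x} {} cX DX X FX" and bY: "builds {y} {} cY DY Y FY"
    and xy: "x \<in> X" "y \<in> Y" and XY: "X \<inter> Y = {}" "V = X \<union> Y" and E: "E = insert {x, y} (FX \<union> FY)"
    and c: "cX + cY + 1 \<le> c" and D: "DX \<union> DY \<subseteq> D - {{x, y}}"
  have new: "{x, y} \<notin> pendant_edges a zs b"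
    using xy XY zs(2) by (auto simp: pendant_edges_def length_Suc_conv doubleton_eq_iff)
  \<comment> \<open>With both ends on one side, the ear extends the build of that side. Here
    \<open>p\<close>, \<open>q\<close> are \<open>x\<close>, \<open>y\<close> in either order, so
    that one argument serves both sides.\<close>
  have same: ?thesis if sp: "builds {p} {} cP DP P EP" "builds {q} {} cQ DQ Q EQ" "p \<in> P" "q \<in> Q"
    "P \<inter> Q = {}" "V = P \<union> Q" "E = insert {p, q} (EP \<union> EQ)" "{p, q} = {x, y}"
    "cP + cQ + 1 \<le> c" "DP \<union> DQ \<subseteq> D - {{x, y}}" "a \<in> P" "b \<in> P"
    for p q cP DP P EP cQ DQ Q EQ
  proof -
    have "set zs \<inter> P = {}" using zs(2) sp by auto
    from builds.ear[OF sp(1) sp(11,12) zs(1) this zs(3)] have "splits p q c' D' V' E'"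
      by (rule splitsI[OF _ sp(2)])
        (use sp(3-10) new zs(2) in \<open>auto simp: c'_def D'_def V'_def E'_def\<close>)
    then show ?thesis using sp(8) splits_sym by (auto simp: doubleton_eq_iff)
  qed
  have across: ?thesis if sp: "builds {p} {} cP DP P EP" "builds {q} {} cQ DQ Q EQ" "p \<in> P" "q \<in> Q"
    "P \<inter> Q = {}" "V = P \<union> Q" "E = insert {p, q} (EP \<union> EQ)" "{p, q} = {x, y}"
    "cP + cQ + 1 \<le> c" "DP \<union> DQ \<subseteq> D - {{x, y}}" "a \<in> P" "b \<in> Q"
    for p q cP DP P EP cQ DQ Q EQ
  \<comment> \<open>An ear that only repeats \<open>{p, q}\<close> changes nothing. Excluding it is
    also what keeps the prolonged ear \<open>ws\<close> from being pendant.\<close>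
  proof (cases "zs = [] \<and> a = p \<and> b = q")
    case True
    then have "E' = E" "V' = V" "c' = c" "D' = D"
      using sp(7) by (auto simp: E'_def V'_def c'_def D'_def pendant_edges_def)
    then show ?thesis using spl by simp
  next
    case False
    show ?thesis
      using builds_along_path[OF sp(2,4,12)]
    proof (rule path_buildE)
      fix ps c1 D1
      assume ps: "ps \<noteq> []" "hd ps = q" "last ps = b" "distinct ps" "builds (set ps) (wE ps) c1 D1 Q EQ"
        and D1: "D1 \<subseteq> DQ" and c1: "c1 + (length ps + 1) mod 2 \<le> cQ"
      have sub: "set ps \<subseteq> Q" "wE ps \<subseteq> EQ" using builds_mono[OF ps(5)] by auto
      define ws where "ws = ps @ rev zs"
      have wsE: "wE (p # ws @ [a]) = {{p, q}} \<union> wE ps \<union> wE (a # zs @ [b])"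
        using wE_join[of ps "[p]" "rev zs @ [a]"] ps wE_ear_rev[of b zs a] by (simp add: ws_def)
      have 1: "builds {p} {} (cP + length ws mod 2) DP (P \<union> set ws) (EP \<union> wE (p # ws @ [a]))"
      proof (rule builds_ear[OF sp(1), of p a ws])
        have "pendant_edges p ws a = {}"
        proof (rule ccontr)
          assume "pendant_edges p ws a \<noteq> {}"
          then have pa: "p = a" "length ws = 1" by (auto simp: pendant_edges_def split: if_splits)
          then have "zs = []" "length ps = 1" using ps(1) by (cases ps; simp add: ws_def)+
          then show False using False pa ps(2,3) by (auto simp: length_Suc_conv)
        qed
        then show "DP = DP \<union> pendant_edges p ws a" by simp
      qed (use sp(3,5,6,11) ps(1,4) zs(1,2) sub in \<open>auto simp: ws_def\<close>)
      have 2: "builds (P \<union> set ws) (EP \<union> wE (p # ws @ [a])) c1 D1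
          (Q \<union> (P \<union> set ws)) (EQ \<union> (EP \<union> wE (p # ws @ [a])))"
      proof (rule builds_extend[OF ps(5)])
        show "wE ps \<subseteq> EP \<union> wE (p # ws @ [a])" unfolding wsE by blast
      qed (use sp(5,6) zs(2) in \<open>auto simp: ws_def\<close>)
      have "Q \<union> (P \<union> set ws) = V'" using sp(6) sub by (auto simp: V'_def ws_def)
      moreover have "EQ \<union> (EP \<union> wE (p # ws @ [a])) = E'"
        unfolding wsE E'_def sp(7) using sub by auto
      ultimately have "builds {p} {} (cP + length ws mod 2 + c1) (DP \<union> D1) V' E'"
        using builds_trans[OF 2 1] by simp
      \<comment> \<open>The unit charged for \<open>{x, y}\<close> in \<open>splits\<close> now pays
        for the prolonged ear, whatever its parity.\<close>
      moreover have "length ws mod 2 \<le> 1" by simp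
      then have "cP + length ws mod 2 + c1 \<le> c'" using c1 sp(9) by (simp add: c'_def)
      moreover have "DP \<union> D1 \<subseteq> D' - {{x, y}}" using D1 sp(10) by (auto simp: D'_def)
      ultimately show ?thesis unfolding avoidable_def by blast
    qed
  qed
  have D2: "DY \<union> DX \<subseteq> D - {{x, y}}" using D by blast
  have sp: "builds {y} {} cY DY Y FY" "builds {x} {} cX DX X FX" "y \<in> Y" "x \<in> X"
    "Y \<inter> X = {}" "V = Y \<union> X" "E = insert {y, x} (FY \<union> FX)" "{y, x} = {x, y}"
    "cY + cX + 1 \<le> c"
    using bX bY xy XY E c by auto
  show ?thesis
    using ab XY(2) same[OF bX bY xy XY E refl c D] across[OF bX bY xy XY E refl c D]
      same[OF sp D2] across[OF sp D2] by blast
qed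

text \<open>When it is added, a pendant edge separates the graph built so far from the single vertex
  \<open>z\<close>. Each later ear keeps the separation or triggers the trade of
  \<open>splits_ear\<close>, and avoidability persists because later ears can be appended to the
  replacement build.\<close>

lemma pendant_splits_or_avoidable:
  assumes "builds {r} {} c D V E" "e \<in> D"
  shows "(\<exists>x y. e = {x, y} \<and> splits x y c D V E) \<or> avoidable e c D V E"
  using assms
proof (induction rule: builds.induct)
  case (ear c D V E a b zs)
  show ?case
  proof (cases "e \<in> D")
    case False
    then have "e \<in> pendant_edges a zs b" using ear.prems by simp
    then obtain z where z: "b = a" "zs = [z]" "e = {a, z}"
      by (auto simp: pendant_edges_def length_Suc_conv split: if_splits)
    show ?thesis
      using builds_along_path[OF ear.hyps(1,2,2)]
    proof (rule path_buildE)
      fix ps c' D'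
      assume ps: "ps \<noteq> []" "hd ps = a" "last ps = a" "distinct ps"
        "builds (set ps) (wE ps) c' D' V E"
        and D': "D' \<subseteq> D" and c': "c' + (length ps + 1) mod 2 \<le> c"
      \<comment> \<open>A path with equal ends and no repetition is a single vertex, so the exchange
        merely moves the root to \<open>a\<close>.\<close>
      have "ps = [a]"
      proof (cases ps)
        case (Cons x xs)
        then show ?thesis using ps(2-4) last_in_set[of xs] by (cases "xs = []") auto
      qed (use ps(1) in simp)
      then have "builds {a} {} c' D' V E" using ps(5) by simp
      then have "splits a z (c + length zs mod 2) (D \<union> pendant_edges a zs b) (V \<union> set zs)
          (E \<union> wE (a # zs @ [b]))"
      proof (rule splitsI[OF _ builds.start[of "{z}" "{}"]])
        have "wE (a # zs @ [b]) = {{a, z}}" using z(1,2) by (auto simp: insert_commute)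
        then show "E \<union> wE (a # zs @ [b]) = insert {a, z} (E \<union> {})" by simp
        show "D' \<union> {} \<subseteq> D \<union> pendant_edges a zs b - {{a, z}}" using D' False z(3) by blast
        show "c' + 0 + 1 \<le> c + length zs mod 2" using c' z(2) by simp
        show "V \<inter> {z} = {}" using ear.hyps(5) z(2) by auto
      qed (use ear.hyps(2) z(2) in auto)
      then show ?thesis using z by blast
    qed
  next
    case True
    from ear.IH[OF this] show ?thesis
    proof
      assume "\<exists>x y. e = {x, y} \<and> splits x y c D V E"
      then obtain x y where "e = {x, y}" "splits x y c D V E" by blast
      then show ?thesis using splits_ear[OF _ ear.hyps(2-6)] by metis
    next
      assume "avoidable e c D V E"
      then obtain r' c' D' where b: "builds {r'} {} c' D' V E" "c' \<le> c" "D' \<subseteq> D - {e}"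
        unfolding avoidable_def by blast
      \<comment> \<open>A later pendant edge contains a new vertex, so \<open>e\<close> cannot be
        collected a second time.\<close>
      have "e \<subseteq> V" using True builds_pendants[OF ear.hyps(1)] builds_edges_within[OF ear.hyps(1)] by auto
      then have "e \<notin> pendant_edges a zs b"
        using ear.hyps(5) by (auto simp: pendant_edges_def length_Suc_conv)
      then show ?thesis using builds.ear[OF b(1) ear.hyps(2-6)] b(2,3)
        unfolding avoidable_def by (intro disjI2 exI conjI) auto
    qed
  qed
qed simp

lemma splits_bridge:
  assumes "splits x y c D V E"
  shows "{x, y} \<in> bridges (Graph V E)"
  using assms
proof (rule splitsE)
  fix X FX cX DX Y FY cY DY
  assume b: "builds {x} {} cX DX X FX" "builds {y} {} cY DY Y FY"
    and xy: "x \<in> X" "y \<in> Y" "X \<inter> Y = {}" and E: "E = insert {x, y} (FX \<union> FY)"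
  have sub: "FX \<subseteq> Pow X" "FY \<subseteq> Pow Y" using builds_edges_within b by blast+
  have "v \<in> X" if "(x, v) \<in> {(u, v). {u, v} \<in> E - {{x, y}}}\<^sup>*" for v
    using that
  proof (induction rule: rtrancl_induct)
    case (step u w)
    then have "{u, w} \<in> FX \<union> FY" using E by auto
    then show ?case using step.IH sub xy(3) by auto
  qed (use xy in auto)
  then have "\<not> reachable (delete_edge (Graph V E) {x, y}) x y"
    using xy unfolding reachable_def delete_edge_def by auto
  moreover have "{x, y} \<in> E" using E by simp
  ultimately show ?thesis unfolding bridges_def by auto
qed

text \<open>Trading away a pendant edge that is not a bridge adds no other pendant edge, so
  \<open>card D\<close> falls while the cost never rises.\<close>

theorem builds_with_bridges:
  assumes "builds {r} {} c D V E"
  obtains r' c' D' where "builds {r'} {} c' D' V E" "c' \<le> c" "D' \<subseteq> bridges (Graph V E)"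
proof -
  have "\<exists>r' c' D'. builds {r'} {} c' D' V E \<and> c' \<le> c \<and> D' \<subseteq> bridges (Graph V E)"
    using assms
  proof (induction "card D" arbitrary: r c D rule: less_induct)
    case less
    show ?case
    proof (cases "D \<subseteq> bridges (Graph V E)")
      case False
      then obtain e where e: "e \<in> D" "e \<notin> bridges (Graph V E)" by blast
      then have "avoidable e c D V E"
        using pendant_splits_or_avoidable[OF less.prems e(1)] splits_bridge by metis
      then obtain r' c' D' where b: "builds {r'} {} c' D' V E" "c' \<le> c" "D' \<subseteq> D - {e}"
        unfolding avoidable_def by blast
      have "card D' < card D"
        using b(3) e(1) builds_pendants_finite[OF less.prems] by (intro psubset_card_mono) auto
      from less.hyps[OF this b(1)] show ?thesis using b(2) le_trans by blast
    qed (use less.prems in blast)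
  qed
  then show ?thesis using that by blast
qed

section \<open>Connectivity and edges on cycles\<close>

definition adj :: "'a set set \<Rightarrow> 'a rel" where
  "adj E = {(x, y). {x, y} \<in> E}"

lemma adj_rtrancl_sym: "(x, y) \<in> (adj E)\<^sup>* \<Longrightarrow> (y, x) \<in> (adj E)\<^sup>*"
  by (rule symD[OF sym_rtrancl]) (auto simp: sym_def adj_def insert_commute)

lemma adj_rtrancl_mono: "E \<subseteq> F \<Longrightarrow> (x, y) \<in> (adj E)\<^sup>* \<Longrightarrow> (x, y) \<in> (adj F)\<^sup>*"
  by (rule rtrancl_mono[THEN subsetD]) (auto simp: adj_def)

lemma adj_rtrancl_trans: "(x, y) \<in> (adj E)\<^sup>* \<Longrightarrow> (y, z) \<in> (adj E)\<^sup>* \<Longrightarrow> (x, z) \<in> (adj E)\<^sup>*"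
  by (rule rtrancl_trans)

lemma walk_connects: "xs \<noteq> [] \<Longrightarrow> wE xs \<subseteq> E \<Longrightarrow> x \<in> set xs \<Longrightarrow> (hd xs, x) \<in> (adj E)\<^sup>*"
proof (induction xs rule: walk_edges.induct)
  case (1 u v xs)
  then have "(u, v) \<in> (adj E)\<^sup>*" by (auto simp: adj_def)
  then show ?case using 1 by (auto intro: adj_rtrancl_trans)
qed auto

lemma builds_connected:
  assumes "builds {r} {} c D V E" "v \<in> V"
  shows "(r, v) \<in> (adj E)\<^sup>*"
  using assms
proof (induction arbitrary: v rule: builds.induct)
  case (ear c D V E a b zs)
  let ?E = "E \<union> wE (a # zs @ [b])"
  have "(r, a) \<in> (adj ?E)\<^sup>*" if "a \<in> V" for a
    using ear.IH[OF that] by (rule adj_rtrancl_mono[rotated]) auto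
  moreover have "(a, v) \<in> (adj ?E)\<^sup>*" if "v \<in> set zs"
    using walk_connects[of "a # zs @ [b]" ?E v] that by auto
  ultimately show ?case using ear by (auto intro: adj_rtrancl_trans)
qed auto

lemma wE_split:
  assumes "e \<in> wE xs"
  obtains ps p q qs where "xs = (ps @ [p]) @ (q # qs)" "e = {p, q}"
proof -
  have "\<exists>ps p q qs. xs = (ps @ [p]) @ (q # qs) \<and> e = {p, q}"
    using assms
  proof (induction xs rule: walk_edges.induct)
    case (1 x y xs)
    show ?case
    proof (cases "e = {x, y}")
      case True
      then show ?thesis by (intro exI[of _ "[]"]) auto
    next
      case False
      then obtain ps p q qs where "y # xs = (ps @ [p]) @ (q # qs)" "e = {p, q}"
        using 1 by auto
      then show ?thesis by (intro exI[of _ "x # ps"]) auto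
    qed
  qed auto
  then show ?thesis using that by blast
qed

text \<open>Deleting an edge of the newest ear leaves pieces of the ear hanging at \<open>a\<close>
  and \<open>b\<close>, which are joined in the old graph. The pieces avoid the deleted edge because
  a non-pendant ear repeats no edge; an older edge keeps its detour.\<close>

lemma non_pendant_edge_on_cycle:
  assumes "builds {r} {} c D V E" "{u, v} \<in> E - D"
  shows "(u, v) \<in> (adj (E - {{u, v}}))\<^sup>*"
  using assms
proof (induction arbitrary: u v rule: builds.induct)
  case (ear c D V E a b zs)
  let ?E = "E \<union> wE (a # zs @ [b])" and ?e = "{u, v}"
  show ?case
  proof (cases "{u, v} \<in> E")
    case True
    then show ?thesis using ear by (intro adj_rtrancl_mono[OF _ ear.IH]) auto
  next
    case False
    then have e: "?e \<in> wE (a # zs @ [b])" "pendant_edges a zs b = {}"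
      using ear.prems by (auto simp: pendant_edges_def length_Suc_conv insert_commute split: if_splits)
    have dist: "distinct (walk_edges (a # zs @ [b]))"
      using ear.hyps e(2) by (intro distinct_walk_edges_ear) auto
    have conn: "(x, y) \<in> (adj (?E - {?e}))\<^sup>*" if "x \<in> V" "y \<in> V" for x y
    proof (rule adj_rtrancl_mono)
      show "E \<subseteq> ?E - {?e}" using False by auto
      show "(x, y) \<in> (adj E)\<^sup>*"
        using builds_connected[OF ear.hyps(1)] that adj_rtrancl_sym adj_rtrancl_trans by metis
    qed
    obtain ps p q qs where w: "a # zs @ [b] = (ps @ [p]) @ (q # qs)" "?e = {p, q}"
      using e(1) by (rule wE_split)
    have we: "walk_edges (a # zs @ [b]) = walk_edges (ps @ [p]) @ {p, q} # walk_edges (q # qs)"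
      unfolding w(1) by (subst walk_edges_append) auto
    have not: "?e \<notin> wE (ps @ [p])" "?e \<notin> wE (q # qs)"
      using dist unfolding we w(2) by auto
    have "(a, p) \<in> (adj (?E - {?e}))\<^sup>*"
    proof -
      have "hd (ps @ [p]) = a" using w(1) by (cases ps) auto
      then show ?thesis using walk_connects[of "ps @ [p]" "?E - {?e}" p] not we by auto
    qed
    moreover have "(q, b) \<in> (adj (?E - {?e}))\<^sup>*"
    proof -
      have "last (q # qs) = b" using arg_cong[OF w(1), of last] by simp
      then show ?thesis
        using walk_connects[of "q # qs" "?E - {?e}" b] not we last_in_set[of "q # qs"] by auto
    qed
    ultimately have "(p, q) \<in> (adj (?E - {?e}))\<^sup>*"
      using conn[OF ear.hyps(2,3)] adj_rtrancl_sym adj_rtrancl_trans by metis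
    then show ?thesis using w(2) adj_rtrancl_sym by (auto simp: doubleton_eq_iff insert_commute)
  qed
qed simp

text \<open>The inclusion opposite to the one in \<open>builds_with_bridges\<close>; together they
  make the pendant edges exactly the bridges.\<close>

lemma bridges_subset_pendants:
  assumes "builds {r} {} c D V E"
  shows "bridges (Graph V E) \<subseteq> D"
  using non_pendant_edge_on_cycle[OF assms]
  by (auto simp: bridges_def reachable_def delete_edge_def adj_def)

section \<open>Builds and generalized ear decompositions\<close>

text \<open>This is why an ear with inner vertices is edge-disjoint from the old graph; only an ear
  without inner vertices can repeat an edge.\<close>

lemma wE_ear_meets: "zs \<noteq> [] \<Longrightarrow> e \<in> wE (a # zs @ [b]) \<Longrightarrow> e \<inter> set zs \<noteq> {}"
proof (induction zs arbitrary: a)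
  case (Cons z zs)
  then show ?case by (cases "zs = []") auto
qed simp

lemma card_wE_ear:
  assumes "distinct zs" "a \<notin> set zs" "b \<notin> set zs" "zs = [] \<Longrightarrow> a \<noteq> b"
    and "pendant_edges a zs b = {}"
  shows "card (wE (a # zs @ [b])) = length zs + 1"
  using distinct_card[OF distinct_walk_edges_ear[OF assms]] length_walk_edges[of "a # zs @ [b]"]
  by simp

definition ged_step :: "'a ugraph \<Rightarrow> 'a ugraph \<Rightarrow> 'a ugraph \<Rightarrow> bool" where
  "ged_step H K F \<longleftrightarrow> ear_of K F \<or> bridge_subgraph H F \<and> card (verts F \<inter> verts K) = 1"

text \<open>\<open>H\<close> stays the final graph while the list grows, since the bridges in a
  decomposition are those of \<open>H\<close>. The condition on the union is therefore kept
  apart.\<close>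

definition ged_prefix :: "'a ugraph \<Rightarrow> 'a ugraph list \<Rightarrow> bool" where
  "ged_prefix H Fs \<longleftrightarrow> Fs \<noteq> [] \<and> (is_cycle (Fs ! 0) \<or> bridge_subgraph H (Fs ! 0)) \<and>
     (\<forall>i. 1 \<le> i \<and> i < length Fs \<longrightarrow> ged_step H (graph_Union (set (take i Fs))) (Fs ! i))"

lemma generalized_ear_decomposition_iff:
  "generalized_ear_decomposition H Fs \<longleftrightarrow> ged_prefix H Fs \<and> graph_Union (set Fs) = H"
  unfolding generalized_ear_decomposition_def ged_prefix_def ged_step_def by auto

lemma ged_prefix_single: "ged_prefix H [F] \<longleftrightarrow> is_cycle F \<or> bridge_subgraph H F"
  unfolding ged_prefix_def by auto

lemma ged_prefix_snoc:
  assumes "Fs \<noteq> []"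
  shows "ged_prefix H (Fs @ [F]) \<longleftrightarrow> ged_prefix H Fs \<and> ged_step H (graph_Union (set Fs)) F"
  using assms unfolding ged_prefix_def
  by (auto simp: nth_append less_Suc_eq Suc_le_eq dest: spec[of _ "length Fs"])

lemma graph_Union_snoc:
  "graph_Union (set (Fs @ [F])) =
    Graph (verts (graph_Union (set Fs)) \<union> verts F) (edges (graph_Union (set Fs)) \<union> edges F)"
  unfolding graph_Union_def by auto

lemma even_ears_snoc:
  "even_ears H (Fs @ [F]) =
    even_ears H Fs + (if \<not> bridge_subgraph H F \<and> even (card (edges F)) then 1 else 0)"
proof -
  let ?P = "\<lambda>F. \<not> bridge_subgraph H F \<and> even (card (edges F))"
  let ?A = "{i. i < length Fs \<and> ?P (Fs ! i)}"
  have "{i. i < length (Fs @ [F]) \<and> ?P ((Fs @ [F]) ! i)} =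
    ?A \<union> (if ?P F then {length Fs} else {})"
    by (auto simp: nth_append less_Suc_eq)
  moreover have "card (?A \<union> (if ?P F then {length Fs} else {})) =
    card ?A + (if ?P F then 1 else 0)"
    by (subst card_Un_disjoint) auto
  ultimately show ?thesis unfolding even_ears_def by simp
qed

lemma even_ears_Nil: "even_ears H [] = 0"
  unfolding even_ears_def by simp

text \<open>\<open>card D\<close> carries the charges of the pendant edges, which turn into bridges
  and are not counted as even ears; an ear repeating an old edge is dropped. The bare root is a
  separate alternative because it has no decomposition.\<close>

lemma ged_of_builds:
  assumes "builds {r} {} c D V E" "D \<subseteq> bridges H"
  shows "(V = {r} \<and> E = {} \<and> D = {}) \<or>
    (\<exists>Fs. ged_prefix H Fs \<and> graph_Union (set Fs) = Graph V E \<and> even_ears H Fs + card D \<le> c)"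
  using assms
proof (induction rule: builds.induct)
  case (ear c D V E a b zs)
  let ?F = "walk_graph (a # zs @ [b])" and ?c = "c + length zs mod 2"
  let ?D = "D \<union> pendant_edges a zs b" and ?V = "V \<union> set zs" and ?E = "E \<union> wE (a # zs @ [b])"
  have F: "verts ?F = insert a (insert b (set zs))" "edges ?F = wE (a # zs @ [b])"
    by (auto simp: walk_graph_eq)
  have sub: "E \<subseteq> Pow V" using builds_edges_within[OF ear.hyps(1)] by simp
  have fin: "finite D" "D \<subseteq> E"
    using builds_pendants_finite[OF ear.hyps(1)] builds_pendants[OF ear.hyps(1)] by auto
  \<comment> \<open>The assumptions cover the two roles of \<open>?F\<close> and its price: over the
    bare root it must be a cycle or a bridge, afterwards it must be a valid step, and its cost must
    pay for an even ear or a new bridge.\<close>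
  have *: ?case if "is_cycle ?F \<or> bridge_subgraph H ?F \<or> V \<noteq> {r}" "ged_step H (Graph V E) ?F"
    "(if \<not> bridge_subgraph H ?F \<and> even (card (edges ?F)) then 1 else 0) + card ?D
      \<le> card D + length zs mod 2"
  proof (cases "V = {r} \<and> E = {} \<and> D = {}")
    case True
    then have "a = r" "b = r" using ear.hyps by auto
    have "ged_prefix H [?F]" unfolding ged_prefix_single using that(1) True by blast
    moreover have "graph_Union (set [?F]) = Graph ?V ?E"
      using True \<open>a = r\<close> \<open>b = r\<close> by (auto simp: graph_Union_def walk_graph_eq)
    moreover have "even_ears H [?F] + card ?D \<le> ?c"
      using that(3) even_ears_snoc[of H "[]" ?F] True by (simp add: even_ears_Nil)
    ultimately show ?thesis by blast
  next
    case False
    then obtain Fs where Fs: "ged_prefix H Fs" "graph_Union (set Fs) = Graph V E"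
      "even_ears H Fs + card D \<le> c"
      using ear.IH ear.prems by auto
    then have "ged_prefix H (Fs @ [?F])"
      using ged_prefix_snoc[of Fs H ?F] that(2) by (auto simp: ged_prefix_def)
    moreover have "graph_Union (set (Fs @ [?F])) = Graph ?V ?E"
      unfolding graph_Union_snoc Fs(2) using F ear.hyps(2,3) by auto
    moreover have "even_ears H (Fs @ [?F]) + card ?D \<le> ?c"
      unfolding even_ears_snoc using Fs(3) that(3) by linarith
    ultimately show ?thesis by blast
  qed
  consider "zs = []" "{a, b} \<in> E" | z where "zs = [z]" "a = b"
    | "pendant_edges a zs b = {}" "zs = [] \<Longrightarrow> {a, b} \<notin> E"
  proof -
    have "pendant_edges a zs b = {} \<or> a = b \<and> (\<exists>z. zs = [z])"
      by (auto simp: pendant_edges_def length_Suc_conv)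
    then show ?thesis using that by blast
  qed
  then show ?case
  proof cases
    case 1
    then have "?c = c" "?D = D" "?V = V" "?E = E" by (auto simp: pendant_edges_def)
    then show ?thesis using ear.IH ear.prems by simp
  next
    case (2 z)
    have D: "?D = insert {a, z} D" and FF: "?F = Graph {a, z} {{a, z}}"
      using 2 by (auto simp: pendant_edges_def walk_graph_eq insert_commute)
    have b: "bridge_subgraph H ?F"
      unfolding bridge_subgraph_def FF using ear.prems D by auto
    have "verts ?F \<inter> V = {a}" using FF ear.hyps(2,5) 2 by auto
    then have "ged_step H (Graph V E) ?F" unfolding ged_step_def using b by simp
    moreover have "{a, z} \<notin> D" using fin sub ear.hyps(5) 2 by auto
    ultimately show ?thesis using b by (intro *) (use fin 2 D in auto)
  next
    case 3
    have notin: "a \<notin> set zs" "b \<notin> set zs" using ear.hyps by auto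
    have card: "card (edges ?F) = length zs + 1"
      unfolding F by (rule card_wE_ear) (use ear.hyps notin 3 in auto)
    have cyc: "cycle_through a ?F" if "a = b"
    proof -
      have "length zs \<ge> 2" using that 3(1) ear.hyps(6)
        by (cases zs; cases "tl zs") (auto simp: pendant_edges_def split: if_splits)
      then show ?thesis unfolding cycle_through_def using that notin ear.hyps(4)
        by (intro exI[of _ "a # zs"]) auto
    qed
    have "path_between a b ?F" if "a \<noteq> b"
      unfolding path_between_def using that notin ear.hyps(4)
      by (intro exI[of _ "a # zs @ [b]"]) auto
    moreover have "edges ?F \<inter> E = {}"
    proof (cases "zs = []")
      case True
      then show ?thesis using 3(2) F by auto
    next
      case False
      show ?thesis
      proof (rule ccontr)
        assume "edges ?F \<inter> E \<noteq> {}"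
        then obtain e where "e \<in> wE (a # zs @ [b])" "e \<in> E" using F by auto
        then show False using wE_ear_meets[OF False] sub ear.hyps(5) by blast
      qed
    qed
    moreover have "verts ?F \<inter> V = {a, b}" using F ear.hyps by auto
    ultimately have "ear_of (Graph V E) ?F"
      unfolding ear_of_def using cyc ear.hyps(2,3) by (intro bexI[of _ a] bexI[of _ b]) auto
    moreover have "is_cycle ?F \<or> V \<noteq> {r}"
      unfolding is_cycle_def using cyc ear.hyps(2,3) by auto
    ultimately show ?thesis
      by (intro *) (use card 3 in \<open>auto simp: ged_step_def odd_iff_mod_2_eq_one\<close>)
  qed
qed simp

lemma bridgeE:
  assumes "bridge_subgraph H F"
  obtains u v where "F = Graph {u, v} {{u, v}}" "u \<noteq> v" "{u, v} \<in> bridges H"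
proof -
  obtain e where e: "e \<in> bridges H" "F = Graph e {e}"
    using assms unfolding bridge_subgraph_def by blast
  then obtain u v where "e = {u, v}" "\<not> reachable (delete_edge H e) u v"
    unfolding bridges_def by blast
  moreover from this have "u \<noteq> v" unfolding reachable_def by auto
  ultimately show ?thesis using that e by blast
qed

lemma builds_of_ged_ear:
  assumes "builds {r} {} c D V E" "a \<in> V" "b \<in> V"
    and F: "if a = b then cycle_through a F else path_between a b F" "verts F \<inter> V = {a, b}"
    and D: "D \<subseteq> bridges H" "c \<le> even_ears H Fs + card D"
  shows "\<exists>c'. builds {r} {} c' D (V \<union> verts F) (E \<union> edges F) \<and>
    c' \<le> even_ears H (Fs @ [F]) + card D"
proof -
  obtain zs where zs: "distinct zs" "a \<notin> set zs" "b \<notin> set zs" "F = walk_graph (a # zs @ [b])"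
    "zs = [] \<Longrightarrow> a \<noteq> b" "pendant_edges a zs b = {}"
  proof (cases "a = b")
    case True
    then obtain xs where xs: "distinct xs" "length xs \<ge> 3" "hd xs = a" "F = walk_graph (xs @ [a])"
      using F unfolding cycle_through_def by auto
    then obtain zs where "xs = a # zs" by (cases xs) auto
    then show ?thesis using xs True by (intro that[of zs]) (auto simp: pendant_edges_def)
  next
    case False
    then obtain xs where xs: "distinct xs" "xs \<noteq> []" "hd xs = a" "last xs = b" "F = walk_graph xs"
      using F unfolding path_between_def by auto
    then obtain ys where ys: "xs = a # ys" by (cases xs) auto
    then have "ys \<noteq> []" using xs(4) False by auto
    then have "xs = a # butlast ys @ [b]" using ys xs(4) by auto
    then show ?thesis using xs False by (intro that[of "butlast ys"]) (auto simp: pendant_edges_def)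
  qed
  have vF: "verts F = insert a (insert b (set zs))" "edges F = wE (a # zs @ [b])"
    by (auto simp: walk_graph_eq zs(4))
  have b: "builds {r} {} (c + length zs mod 2) D (V \<union> verts F) (E \<union> edges F)"
  proof (rule builds_ear[OF assms(1-3) zs(1)])
    show "set zs \<inter> V = {}" using F(2) zs(2,3) unfolding vF by auto
  qed (use zs vF assms in auto)
  have "c + length zs mod 2 \<le> even_ears H (Fs @ [F]) + card D"
  proof (cases "even (length zs)")
    case True
    then show ?thesis using D unfolding even_ears_snoc by auto
  next
    case False
    have card: "card (edges F) = length zs + 1"
      unfolding vF by (rule card_wE_ear) (use zs in auto)
    \<comment> \<open>\<open>even_ears\<close> skips bridges, so an ear charged one unit must be
      shown not to be one: it has evenly many edges, a bridge has one.\<close>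
    have "\<not> bridge_subgraph H F"
    proof
      assume "bridge_subgraph H F"
      then have "card (edges F) = 1" by (elim bridgeE) simp
      then show False using card False by auto
    qed
    then show ?thesis using D card False unfolding even_ears_snoc
      by (auto simp: odd_iff_mod_2_eq_one)
  qed
  then show ?thesis using b by blast
qed

text \<open>The bridge enters as the closed ear \<open>u, v, u\<close>. Its charge is balanced by
  the growth of \<open>D\<close>, which is strict since \<open>v\<close> is new; appending
  \<open>F\<close> to the list never lowers \<open>even_ears\<close>.\<close>

lemma builds_of_ged_bridge:
  assumes "builds {r} {} c D V E" and uv: "u \<in> V" "v \<notin> V" "{u, v} \<in> bridges H"
    and D: "D \<subseteq> bridges H" "c \<le> even_ears H Fs + card D"
  shows "\<exists>c' D'. builds {r} {} c' D' (V \<union> {u, v}) (E \<union> {{u, v}}) \<and> D' \<subseteq> bridges H \<and>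
    c' \<le> even_ears H (Fs @ [F]) + card D'"
proof (intro exI conjI)
  show "builds {r} {} (c + 1) (insert {u, v} D) (V \<union> {u, v}) (E \<union> {{u, v}})"
    by (rule builds_ear[OF assms(1) uv(1,1), of "[v]"])
      (use uv in \<open>auto simp: pendant_edges_def insert_commute\<close>)
  have "{u, v} \<notin> D"
    using builds_pendants[OF assms(1)] builds_edges_within[OF assms(1)] uv(2) by auto
  then show "c + 1 \<le> even_ears H (Fs @ [F]) + card (insert {u, v} D)"
    using D builds_pendants_finite[OF assms(1)] unfolding even_ears_snoc by auto
qed (use D uv in auto)

lemma doubleton_Int_singleton:
  "u \<noteq> v \<Longrightarrow> {u, v} \<inter> X = {w} \<Longrightarrow> u \<in> X \<and> v \<notin> X \<or> v \<in> X \<and> u \<notin> X"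
  by (cases "u \<in> X"; cases "v \<in> X") auto

lemma builds_of_ged:
  assumes "ged_prefix H Fs"
  shows "\<exists>r c D. builds {r} {} c D (verts (graph_Union (set Fs))) (edges (graph_Union (set Fs))) \<and>
    D \<subseteq> bridges H \<and> c \<le> even_ears H Fs + card D"
  using assms
proof (induction Fs rule: rev_induct)
  case Nil
  then show ?case by (simp add: ged_prefix_def)
next
  case (snoc F Fs)
  have U: "verts (graph_Union (set (Fs @ [F]))) = verts (graph_Union (set Fs)) \<union> verts F"
    "edges (graph_Union (set (Fs @ [F]))) = edges (graph_Union (set Fs)) \<union> edges F"
    unfolding graph_Union_snoc by simp_all
  show ?case
  proof (cases "Fs = []")
    case True
    have 0: "builds {r} {} 0 {} {r} {}" for r :: 'a by (rule builds.start)
    from snoc.prems True have "is_cycle F \<or> bridge_subgraph H F" by (simp add: ged_prefix_single)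
    then show ?thesis
    proof
      assume "is_cycle F"
      then obtain a where a: "cycle_through a F" unfolding is_cycle_def by blast
      then have "a \<in> verts F" by (auto simp: cycle_through_def walk_graph_eq)
      then show ?thesis using builds_of_ged_ear[OF 0[of a], of a a F H "[]"] a True
        by (auto simp: even_ears_Nil graph_Union_def insert_absorb intro!: exI[of _ a] exI[of _ "{}"])
    next
      assume "bridge_subgraph H F"
      then obtain u v where "F = Graph {u, v} {{u, v}}" "u \<noteq> v" "{u, v} \<in> bridges H"
        by (rule bridgeE)
      moreover have "{u, v, u} = {u, v}" by auto
      ultimately show ?thesis using builds_of_ged_bridge[OF 0[of u], of u v H "[]" F] True
        by (auto simp: even_ears_Nil graph_Union_def)
    qed
  next
    case False
    then have p: "ged_prefix H Fs" "ged_step H (graph_Union (set Fs)) F"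
      using ged_prefix_snoc[OF False] snoc.prems by auto
    from snoc.IH[OF p(1)] obtain r c D where b:
      "builds {r} {} c D (verts (graph_Union (set Fs))) (edges (graph_Union (set Fs)))"
      "D \<subseteq> bridges H" "c \<le> even_ears H Fs + card D" by blast
    from p(2) show ?thesis unfolding ged_step_def
    proof
      assume "ear_of (graph_Union (set Fs)) F"
      then show ?thesis unfolding ear_of_def
        using builds_of_ged_ear[OF b(1) _ _ _ _ b(2,3)] U b(2) by metis
    next
      assume F: "bridge_subgraph H F \<and> card (verts F \<inter> verts (graph_Union (set Fs))) = 1"
      then obtain u v where uv: "F = Graph {u, v} {{u, v}}" "u \<noteq> v" "{u, v} \<in> bridges H"
        by (blast elim: bridgeE)
      obtain w where "{u, v} \<inter> verts (graph_Union (set Fs)) = {w}"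
        using F uv(1) by (auto simp: card_1_singleton_iff)
      then consider "u \<in> verts (graph_Union (set Fs))" "v \<notin> verts (graph_Union (set Fs))"
        | "v \<in> verts (graph_Union (set Fs))" "u \<notin> verts (graph_Union (set Fs))"
        using doubleton_Int_singleton[OF uv(2)] by meson
      then show ?thesis
      proof cases
        case 1
        then show ?thesis using builds_of_ged_bridge[OF b(1) 1 uv(3) b(2,3), of F] U uv(1) by auto
      next
        case 2
        have "{v, u} \<in> bridges H" using uv(3) by (simp add: insert_commute)
        then show ?thesis using builds_of_ged_bridge[OF b(1) 2 _ b(2,3), of F] U uv(1)
          by (auto simp: insert_commute)
      qed
    qed
  qed
qed

section \<open>Existence of builds and their least cost\<close>

lemma builds_add_edges:
  assumes "builds V0 E0 c D V E" "finite F" "\<And>e. e \<in> F \<Longrightarrow> e \<subseteq> V \<and> card e = 2"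
  shows "builds V0 E0 c D V (E \<union> F)"
  using assms(2,3)
proof (induction F rule: finite_induct)
  case (insert e F)
  obtain u v where e: "e = {u, v}" "u \<noteq> v" using insert.prems[of e] by (auto simp: card_2_iff)
  have b: "builds V0 E0 c D V (E \<union> F)" using insert by blast
  show ?case
    by (rule builds_ear[OF b, of u v "[]"]) (use e insert.prems[of e] in \<open>auto simp: pendant_edges_def\<close>)
qed (use assms(1) in simp)

lemma crossing_edge:
  assumes "(x, y) \<in> (adj E)\<^sup>*" "x \<in> W" "y \<notin> W"
  obtains u v where "{u, v} \<in> E" "u \<in> W" "v \<notin> W"
proof -
  have "\<exists>u v. {u, v} \<in> E \<and> u \<in> W \<and> v \<notin> W"
    using assms by (induction rule: rtrancl_induct) (auto simp: adj_def)
  then show ?thesis using that by blast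
qed

lemma simple_graph_finite_edges: "simple_graph G \<Longrightarrow> finite (edges G)"
  unfolding simple_graph_def by (rule finite_subset[of _ "Pow (verts G)"]) auto

text \<open>A spanning tree grows by pendant edges along edges leaving the current vertex set; all
  other edges are ears without inner vertices, hence odd and free. The cost is left open, as this
  serves existence.\<close>

lemma connected_builds:
  assumes "simple_graph G" "connected_graph G" "r \<in> verts G"
  obtains c D where "builds {r} {} c D (verts G) (edges G)"
proof -
  have sub: "e \<subseteq> verts G \<and> card e = 2" if "e \<in> edges G" for e
    using assms(1) that unfolding simple_graph_def by auto
  have "finite (verts G)" using assms(1) unfolding simple_graph_def by simp
  have "\<exists>c D. builds {r} {} c D (verts G) (edges G)"
    if "builds {r} {} c D W E" "W \<subseteq> verts G" "E \<subseteq> edges G" for c D W E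
    using that
  proof (induction "card (verts G - W)" arbitrary: c D W E rule: less_induct)
    case less
    show ?case
    proof (cases "W = verts G")
      case True
      have "builds {r} {} c D W (E \<union> edges G)"
        using builds_add_edges[OF less.prems(1) simple_graph_finite_edges[OF assms(1)]] sub True
        by blast
      then show ?thesis using True less.prems(3) by (auto simp: Un_absorb1)
    next
      case False
      then obtain y where y: "y \<in> verts G" "y \<notin> W" using less.prems by blast
      have r: "r \<in> W" using builds_mono[OF less.prems(1)] by simp
      have "(r, y) \<in> (adj (edges G))\<^sup>*"
        using assms(2,3) y unfolding connected_graph_def reachable_def adj_def by blast
      then obtain u v where uv: "{u, v} \<in> edges G" "u \<in> W" "v \<notin> W"
        using crossing_edge r y(2) by metis
      have v: "v \<in> verts G" using sub[OF uv(1)] by auto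
      have "builds {r} {} (c + 1) (D \<union> {{u, v}}) (W \<union> {v}) (E \<union> {{u, v}})"
        by (rule builds_ear[OF less.prems(1) uv(2,2), of "[v]"])
          (use uv in \<open>auto simp: pendant_edges_def insert_commute\<close>)
      moreover have "card (verts G - (W \<union> {v})) < card (verts G - W)"
        using \<open>finite (verts G)\<close> v uv(3) by (intro psubset_card_mono) auto
      ultimately show ?thesis using less.hyps less.prems v uv(1) by blast
    qed
  qed
  from this[OF builds.start] show ?thesis using assms(3) that by auto
qed

text \<open>Once the pendant edges are exactly the bridges, the cost separates into even ears and
  bridges.\<close>

lemma phi_plus_bridges_le:
  assumes "builds {r} {} c D (verts H) (edges H)" "edges H \<noteq> {}"
  shows "\<exists>Fs. generalized_ear_decomposition H Fs"
    "phi_connected H + card (bridges H) \<le> c"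
proof -
  obtain r' c' D' where b: "builds {r'} {} c' D' (verts H) (edges H)" "c' \<le> c"
    "D' \<subseteq> bridges (Graph (verts H) (edges H))"
    using builds_with_bridges[OF assms(1)] .
  then have D: "D' \<subseteq> bridges H" by simp
  obtain Fs where Fs: "generalized_ear_decomposition H Fs" "even_ears H Fs + card D' \<le> c'"
    using ged_of_builds[OF b(1) D] assms(2) by (auto simp: generalized_ear_decomposition_iff)
  show "\<exists>Fs. generalized_ear_decomposition H Fs" using Fs by blast
  have "bridges H = D'" using bridges_subset_pendants[OF b(1)] D by simp
  moreover have "phi_connected H \<le> even_ears H Fs"
    unfolding phi_connected_def using Fs by (intro Least_le) blast
  ultimately show "phi_connected H + card (bridges H) \<le> c" using Fs b by simp
qed

lemma builds_phi_plus_bridges: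
  assumes "simple_graph H" "connected_graph H" "edges H \<noteq> {}"
  obtains r c D where "builds {r} {} c D (verts H) (edges H)"
    "c \<le> phi_connected H + card (bridges H)"
proof -
  obtain r where "r \<in> verts H" using assms(2) unfolding connected_graph_def by blast
  then obtain c D where "builds {r} {} c D (verts H) (edges H)"
    using connected_builds assms by metis
  \<comment> \<open>The \<open>LEAST\<close> in \<open>phi_connected\<close> is attained only if
    some decomposition exists; an arbitrary build provides one.\<close>
  then have "\<exists>Fs. generalized_ear_decomposition H Fs"
    using phi_plus_bridges_le(1) assms(3) by metis
  then have "\<exists>n Fs. generalized_ear_decomposition H Fs \<and> even_ears H Fs = n" by blast
  then have "\<exists>Fs. generalized_ear_decomposition H Fs \<and> even_ears H Fs = phi_connected H"
    unfolding phi_connected_def by (rule LeastI_ex)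
  then obtain Fs where Fs: "ged_prefix H Fs" "graph_Union (set Fs) = H"
      "even_ears H Fs = phi_connected H"
    by (auto simp: generalized_ear_decomposition_iff)
  then obtain r c D where b: "builds {r} {} c D (verts H) (edges H)"
    "D \<subseteq> bridges H" "c \<le> phi_connected H + card D"
    using builds_of_ged[OF Fs(1)] unfolding Fs(2,3) by blast
  have "finite (bridges H)"
    using simple_graph_finite_edges[OF assms(1)] by (rule finite_subset[rotated]) (auto simp: bridges_def)
  then have "card D \<le> card (bridges H)" using b(2) by (rule card_mono)
  then show ?thesis using that[OF b(1)] b(3) by linarith
qed

section \<open>From factor-critical replications to builds\<close>

text \<open>A repeated or old vertex splits the walk in two; of the two parts of a walk with an odd number
  of edges, only one can have an even number of edges, and the repetition pays for it.\<close>

lemma builds_add_walk: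
  assumes "builds V0 E0 c D V E" "finite V" "a \<in> V" "b \<in> V" "\<forall>e \<in> wE (a # zs @ [b]). card e = 2"
  shows "\<exists>c' D'. builds V0 E0 c' D' (V \<union> set zs) (E \<union> wE (a # zs @ [b])) \<and>
    c' + card (V \<union> set zs) \<le> c + card V + length zs + length zs mod 2"
  using assms
proof (induction "length zs" arbitrary: zs a b c D V E rule: less_induct)
  case less
  \<comment> \<open>One parity calculation serves both kinds of cut: \<open>z\<close> is present by
    the time the second walk is added, and it accounts for the extra 1 in
    \<open>length zs\<close>.\<close>
  have two: ?case if h: "length us + length vs < length zs" "z \<in> V \<union> set us" "z' \<in> V \<union> set us"
    "e \<in> V" "set zs = set us \<union> set vs \<union> {z}"
    "wE (a # zs @ [b]) = wE (a # us @ [e]) \<union> wE (z # vs @ [z'])"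
    "length zs = length us + length vs + 1" for us vs z z' e
  proof -
    have sm: "length us < length zs" "length vs < length zs" using h(1) by auto
    have card2: "\<forall>e \<in> wE (a # us @ [e]). card e = 2" "\<forall>e \<in> wE (z # vs @ [z']). card e = 2"
      using less.prems(5) h(6) by auto
    obtain c1 D1 where 1: "builds V0 E0 c1 D1 (V \<union> set us) (E \<union> wE (a # us @ [e]))"
      "c1 + card (V \<union> set us) \<le> c + card V + length us + length us mod 2"
      using less.hyps[OF sm(1) less.prems(1,2,3) h(4) card2(1)] by blast
    obtain c2 D2 where 2: "builds V0 E0 c2 D2 (V \<union> set us \<union> set vs)
        (E \<union> wE (a # us @ [e]) \<union> wE (z # vs @ [z']))"
      "c2 + card (V \<union> set us \<union> set vs) \<le> c1 + card (V \<union> set us) + length vs + length vs mod 2"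
      using less.hyps[OF sm(2) 1(1) _ h(2,3) card2(2)] less.prems(2) by auto
    have "V \<union> set us \<union> set vs = V \<union> set zs" using h by auto
    moreover have "E \<union> wE (a # us @ [e]) \<union> wE (z # vs @ [z']) = E \<union> wE (a # zs @ [b])"
      unfolding h(6) by auto
    moreover have "length us + length us mod 2 + length vs + length vs mod 2 \<le> length zs + length zs mod 2"
      unfolding h(7) by (auto simp: mod_2_eq_odd of_bool_def)
    ultimately show ?thesis using 1(2) 2 by (intro exI[of _ c2] exI[of _ D2]) auto
  qed
  consider "distinct zs" "set zs \<inter> V = {}" | z where "z \<in> set zs" "z \<in> V" | "\<not> distinct zs"
    by auto
  then show ?case
  proof cases
    case 1
    have "zs = [] \<Longrightarrow> a \<noteq> b" using less.prems(5) by auto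
    from builds.ear[OF less.prems(1,3,4) 1 this] show ?thesis
      using 1 less.prems(2)
      by (intro exI conjI) (auto simp: card_Un_disjoint distinct_card Int_commute)
  next
    case 2
    obtain us vs where zs: "zs = us @ z # vs" using 2(1) by (meson split_list)
    show ?thesis
      by (rule two[of us vs z b z]) (use zs 2 less.prems wE_ear_split[of a us z vs b] in auto)
  next
    case 3
    \<comment> \<open>The loop at the repeated vertex is cut out: the shortened walk is added first,
      then the loop as a closed walk at \<open>z\<close>, which is present by now.\<close>
    obtain us z ms vs where zs: "zs = us @ [z] @ ms @ [z] @ vs"
      using not_distinct_decomp[OF 3] by blast
    have "wE (a # zs @ [b]) = wE (a # us @ [z]) \<union> wE (z # ms @ [z]) \<union> wE (z # vs @ [b])"
      using zs wE_ear_split[of a us z "ms @ z # vs" b] wE_ear_split[of z ms z vs b] by auto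
    moreover have "wE (a # (us @ z # vs) @ [b]) = wE (a # us @ [z]) \<union> wE (z # vs @ [b])"
      by (rule wE_ear_split)
    ultimately show ?thesis
      by (intro two[of "us @ z # vs" ms z z b]) (use zs less.prems in auto)
  qed
qed

lemma wE_map: "wE (map f xs) = image f ` wE xs"
  by (induction xs rule: walk_edges.induct) auto

lemma edges_replication_fst:
  "e \<in> edges (replication b G) \<Longrightarrow> fst ` e \<in> edges G"
  unfolding replication_def by auto

lemma simple_graph_replication:
  assumes "simple_graph G"
  shows "simple_graph (replication b G)"
proof -
  have "u \<noteq> v \<and> u \<in> verts G \<and> v \<in> verts G" if "{u, v} \<in> edges G" for u v
  proof -
    have "{u, v} \<subseteq> verts G \<and> card {u, v} = 2" using assms that unfolding simple_graph_def by blast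
    then show ?thesis by (cases "u = v") auto
  qed
  then show ?thesis using assms unfolding simple_graph_def replication_def by fastforce
qed

text \<open>A perfect matching of \<open>X\<close> as a fixed-point-free involution, so that
  alternating paths arise by iterating two functions.\<close>

definition matched_by :: "('a \<Rightarrow> 'a) \<Rightarrow> 'a set \<Rightarrow> 'a set set \<Rightarrow> bool" where
  "matched_by m X E \<longleftrightarrow> (\<forall>x \<in> X. m x \<in> X \<and> m x \<noteq> x \<and> m (m x) = x \<and> {x, m x} \<in> E)"

lemma perfect_matching_function:
  assumes "simple_graph G" "perfect_matching (delete_vertex G p) M"
  obtains m where "matched_by m (verts G - {p}) (edges G)"
proof -
  have M: "M \<subseteq> edges G" "\<And>e f. e \<in> M \<Longrightarrow> f \<in> M \<Longrightarrow> e \<noteq> f \<Longrightarrow> e \<inter> f = {}"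
    "\<Union>M = verts G - {p}"
    using assms(2) unfolding perfect_matching_def matching_def delete_vertex_def induced_def by auto
  have ex: "\<exists>y. {x, y} \<in> M \<and> y \<noteq> x" if x: "x \<in> verts G - {p}" for x
  proof -
    obtain e where e: "e \<in> M" "x \<in> e" using x M(3) by blast
    then have "card e = 2" using M(1) assms(1) unfolding simple_graph_def by blast
    then show ?thesis using e by (auto simp: card_2_iff insert_commute)
  qed
  define m where "m x = (SOME y. {x, y} \<in> M \<and> y \<noteq> x)" for x
  have m: "{x, m x} \<in> M \<and> m x \<noteq> x" if "x \<in> verts G - {p}" for x
    unfolding m_def using someI_ex[OF ex[OF that]] .
  have "m x \<in> verts G - {p} \<and> m x \<noteq> x \<and> m (m x) = x \<and> {x, m x} \<in> edges G"
    if x: "x \<in> verts G - {p}" for x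
  proof -
    have 1: "m x \<in> verts G - {p}" using m[OF x] M(3) by blast
    have "{m x, m (m x)} = {x, m x}"
      using M(2)[of "{m x, m (m x)}" "{x, m x}"] m[OF x] m[OF 1] by blast
    then have "m (m x) = x" using m[OF x] m[OF 1] by (metis doubleton_eq_iff)
    then show ?thesis using 1 m[OF x] M(1) by blast
  qed
  then show ?thesis using that unfolding matched_by_def by blast
qed

text \<open>Following \<open>m\<close> and \<open>m'\<close> alternately from \<open>y\<close>, which is not a value of \<open>m'\<close>, one never returns
  to a visited vertex.\<close>

lemma alternating_path:
  assumes "finite Z" "y \<in> Z" "matched_by m Z E"
    "\<And>v. v \<in> Z - {y} \<Longrightarrow>
      m' v \<noteq> y \<and> m' v \<noteq> v \<and> {v, m' v} \<in> E \<and> (m' v \<in> Z \<longrightarrow> m' (m' v) = v)"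
  shows "\<exists>ys. distinct ys \<and> even (length ys) \<and> ys \<noteq> [] \<and> hd ys = y \<and> set ys \<subseteq> Z \<and>
    m ` set ys \<subseteq> set ys \<and> wE ys \<subseteq> E \<and> last ys \<noteq> y \<and> m' (last ys) \<notin> Z"
  using assms
proof (induction "card Z" arbitrary: Z y rule: less_induct)
  case less
  have m: "m v \<in> Z" "m v \<noteq> v" "m (m v) = v" "{v, m v} \<in> E" if "v \<in> Z" for v
    using less.prems(3) that unfolding matched_by_def by auto
  let ?w = "m y"
  have w: "?w \<in> Z - {y}" using m less.prems(2) by auto
  show ?case
  proof (cases "m' ?w \<in> Z")
    case False
    then show ?thesis using m[OF less.prems(2)] w less.prems(2) by (intro exI[of _ "[y, ?w]"]) auto
  next
    case True
    \<comment> \<open>The pair \<open>y\<close>, \<open>?w\<close> is removed and the path continues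
      from \<open>?u\<close>. In the smaller set \<open>?u\<close> is no value of \<open>m'\<close>,
      since its only preimage in \<open>Z\<close> is the deleted \<open>?w\<close>.\<close>
    let ?u = "m' ?w" and ?Z = "Z - {y, ?w}"
    have u: "?u \<in> ?Z" "{?w, ?u} \<in> E" using True less.prems(4)[OF w] by auto
    have "\<exists>ys. distinct ys \<and> even (length ys) \<and> ys \<noteq> [] \<and> hd ys = ?u \<and> set ys \<subseteq> ?Z \<and>
      m ` set ys \<subseteq> set ys \<and> wE ys \<subseteq> E \<and> last ys \<noteq> ?u \<and> m' (last ys) \<notin> ?Z"
    proof (rule less.hyps)
      show "card ?Z < card Z" using less.prems(1,2) by (intro psubset_card_mono) auto
      show "matched_by m ?Z E" unfolding matched_by_def using m less.prems(2)
        by (metis DiffD1 DiffD2 DiffI insert_iff empty_iff)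
      show "m' v \<noteq> ?u \<and> m' v \<noteq> v \<and> {v, m' v} \<in> E \<and> (m' v \<in> ?Z \<longrightarrow> m' (m' v) = v)"
        if "v \<in> ?Z - {?u}" for v
        using less.prems(4)[of v] less.prems(4)[OF w] u that by auto
    qed (use u less.prems(1) in auto)
    then obtain ys where ys: "distinct ys" "even (length ys)" "ys \<noteq> []" "hd ys = ?u" "set ys \<subseteq> ?Z"
      "m ` set ys \<subseteq> set ys" "wE ys \<subseteq> E" "last ys \<noteq> ?u" "m' (last ys) \<notin> ?Z" by blast
    have l: "last ys \<in> ?Z" using ys(3,5) last_in_set by blast
    then have "m' (last ys) \<noteq> y" using less.prems(4)[of "last ys"] by auto
    \<comment> \<open>Otherwise \<open>last ys\<close> would be \<open>?u\<close>; the conclusion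
      \<open>last ys \<noteq> y\<close> is carried through the induction to exclude this.\<close>
    moreover have "m' (last ys) \<noteq> ?w"
    proof
      assume eq: "m' (last ys) = ?w"
      then have "m' ?w = last ys" using less.prems(4)[of "last ys"] l w by auto
      then show False using ys(8) by simp
    qed
    ultimately have "m' (last ys) \<notin> Z" using ys(9) by auto
    then show ?thesis using ys u w m[OF less.prems(2)] less.prems(2) l
      by (intro exI[of _ "y # ?w # ys"]) (auto simp: walk_edges_Cons)
  qed
qed

text \<open>Fix a near-perfect matching \<open>m\<close> missing \<open>r\<close> and enlarge a set
  \<open>X\<close> containing \<open>r\<close> whose complement is matched by \<open>m\<close>. Each
  enlargement is an alternating ear with evenly many inner vertices; projecting it costs at most the
  number of its vertices that cover no new base vertex. So the cost never exceeds
  \<open>card X\<close> minus the number of base vertices covered.\<close>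

theorem factor_critical_replication_builds:
  assumes H: "simple_graph H" "verts H \<noteq> {}" and fc: "factor_critical (replication b H)"
    and b: "\<And>v. v \<in> verts H \<Longrightarrow> b v \<ge> 1"
  obtains r c D where "builds {r} {} c D (verts H) (edges H)"
    "c + card (verts H) \<le> (\<Sum>v\<in>verts H. b v)"
proof -
  let ?P = "replication b H"
  let ?V = "verts ?P" and ?E = "edges ?P"
  have P: "simple_graph ?P" by (rule simple_graph_replication[OF H(1)])
  then have fin: "finite ?V" unfolding simple_graph_def by simp
  have V: "?V = (SIGMA v:verts H. {1..b v})" unfolding replication_def by simp
  have fstV: "fst ` ?V = verts H"
    unfolding V using b by (force simp: image_iff)
  have "\<exists>m. matched_by m (?V - {p}) ?E" if "p \<in> ?V" for p
    using fc that perfect_matching_function[OF P] unfolding factor_critical_def by metis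
  then obtain f where f: "matched_by (f p) (?V - {p}) ?E" if "p \<in> ?V" for p by metis
  obtain r where r: "r \<in> ?V" using H(2) fstV by fastforce
  define m where "m = f r"
  have path: "\<exists>ys. distinct ys \<and> even (length ys) \<and> ys \<noteq> [] \<and> hd ys = y \<and> set ys \<subseteq> ?V - X \<and>
      m ` set ys \<subseteq> set ys \<and> wE ys \<subseteq> ?E \<and> last ys \<noteq> y \<and> f y (last ys) \<in> X \<and>
      {last ys, f y (last ys)} \<in> ?E"
    if X: "X \<subseteq> ?V" "matched_by m (?V - X) ?E" "y \<in> ?V - X" for X y
  proof -
    have fy: "f y v \<in> ?V - {y} \<and> f y v \<noteq> v \<and> f y (f y v) = v \<and> {v, f y v} \<in> ?E"
      if "v \<in> ?V - {y}" for v
      using f[of y] X(3) that unfolding matched_by_def by auto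
    have "\<exists>ys. distinct ys \<and> even (length ys) \<and> ys \<noteq> [] \<and> hd ys = y \<and> set ys \<subseteq> ?V - X \<and>
      m ` set ys \<subseteq> set ys \<and> wE ys \<subseteq> ?E \<and> last ys \<noteq> y \<and> f y (last ys) \<notin> ?V - X"
      by (rule alternating_path) (use fin X fy in auto)
    then obtain ys where ys: "distinct ys" "even (length ys)" "ys \<noteq> []" "hd ys = y"
      "set ys \<subseteq> ?V - X" "m ` set ys \<subseteq> set ys" "wE ys \<subseteq> ?E" "last ys \<noteq> y" "f y (last ys) \<notin> ?V - X"
      by blast
    have "last ys \<in> ?V - {y}" using ys(3,5,8) last_in_set by blast
    from fy[OF this] show ?thesis using ys by blast
  qed
  have "\<exists>c D E. builds {fst r} {} c D (fst ` ?V) E \<and> E \<subseteq> edges H \<and> c + card (fst ` ?V) \<le> card ?V"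
    if "r \<in> X" "X \<subseteq> ?V" "matched_by m (?V - X) ?E" "builds {fst r} {} c D (fst ` X) E"
      "E \<subseteq> edges H" "c + card (fst ` X) \<le> card X" for X c D E
    using that
  proof (induction "card (?V - X)" arbitrary: X c D E rule: less_induct)
    case less
    show ?case
    proof (cases "X = ?V")
      case False
      then obtain y where y: "y \<in> ?V - X" using less.prems by blast
      \<comment> \<open>\<open>y\<close> may be far from \<open>X\<close>. Alternating from it with
        \<open>f y\<close> only locates a vertex \<open>z\<close> outside \<open>X\<close> with a
        neighbour in \<open>X\<close>; a second alternating path, from \<open>z\<close> with
        \<open>f z\<close>, has both ends attached to \<open>X\<close>.\<close>
      obtain ys where ys: "ys \<noteq> []" "set ys \<subseteq> ?V - X" "f y (last ys) \<in> X"
        "{last ys, f y (last ys)} \<in> ?E"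
        using path[OF less.prems(2,3) y] by blast
      define z x where "z = last ys" and "x = f y (last ys)"
      have z: "z \<in> ?V - X" using ys(1,2) last_in_set unfolding z_def by blast
      obtain zs where zs: "distinct zs" "even (length zs)" "zs \<noteq> []" "hd zs = z" "set zs \<subseteq> ?V - X"
        "m ` set zs \<subseteq> set zs" "wE zs \<subseteq> ?E" "f z (last zs) \<in> X" "{last zs, f z (last zs)} \<in> ?E"
        using path[OF less.prems(2,3) z] by blast
      define x' where "x' = f z (last zs)"
      have xz: "x \<in> X" "x' \<in> X" "{x, z} \<in> ?E" "{last zs, x'} \<in> ?E"
        using ys(3,4) zs(8,9) by (auto simp: x_def z_def x'_def insert_commute)
      have "wE (x # zs @ [x']) = {{x, z}} \<union> wE zs \<union> {{last zs, x'}}"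
        using zs(3,4) by (auto simp: wE_append walk_edges_Cons)
      then have walk: "wE (x # zs @ [x']) \<subseteq> ?E" using xz zs(7) by auto
      have "wE (fst x # map fst zs @ [fst x']) = image fst ` wE (x # zs @ [x'])"
        using wE_map[of fst "x # zs @ [x']"] by simp
      then have walkH: "wE (fst x # map fst zs @ [fst x']) \<subseteq> edges H"
        using subsetD[OF walk, THEN edges_replication_fst] by (auto simp del: walk_edges.simps)
      have fX: "finite (fst ` X)" "finite X" using finite_subset[OF less.prems(2) fin] by auto
      \<comment> \<open>The projected walk may repeat vertices, meet old ones or turn back along an
        edge. As \<open>length zs\<close> is even, the parity term of \<open>builds_add_walk\<close>
        vanishes.\<close>
      have "\<exists>c' D'. builds {fst r} {} c' D' (fst ` X \<union> set (map fst zs))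
           (E \<union> wE (fst x # map fst zs @ [fst x'])) \<and>
         c' + card (fst ` X \<union> set (map fst zs))
           \<le> c + card (fst ` X) + length (map fst zs) + length (map fst zs) mod 2"
        using walkH H(1) xz unfolding simple_graph_def
        by (intro builds_add_walk[OF less.prems(4) fX(1)]) auto
      then obtain c' D' where b': "builds {fst r} {} c' D' (fst ` (X \<union> set zs))
           (E \<union> wE (fst x # map fst zs @ [fst x']))"
         "c' + card (fst ` (X \<union> set zs)) \<le> c + card (fst ` X) + length zs"
        using zs(2) by (auto simp: image_Un)
      have cardX: "card (X \<union> set zs) = card X + length zs"
        using zs(1,5) fX(2) by (subst card_Un_disjoint) (auto simp: distinct_card)
      show ?thesis
      proof (rule less.hyps[OF _ _ _ _ b'(1)])
        show "card (?V - (X \<union> set zs)) < card (?V - X)"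
          using z hd_in_set[OF zs(3)] zs(4) fin by (intro psubset_card_mono) auto
        show "matched_by m (?V - (X \<union> set zs)) ?E"
          unfolding matched_by_def
        proof
          fix v assume v: "v \<in> ?V - (X \<union> set zs)"
          then have mv: "m v \<in> ?V - X" "m v \<noteq> v" "m (m v) = v" "{v, m v} \<in> ?E"
            using less.prems(3) unfolding matched_by_def by auto
          then have "m v \<notin> set zs" using zs(6) v by (metis DiffD2 UnI2 image_subset_iff)
          then show "m v \<in> ?V - (X \<union> set zs) \<and> m v \<noteq> v \<and> m (m v) = v \<and> {v, m v} \<in> ?E"
            using mv by blast
        qed
      qed (use less.prems walkH zs(5) cardX b'(2) in auto)
    qed (use less.prems in blast)
  qed
  from this[of "{r}" 0 "{}" "{}"] obtain c D E where
    b1: "builds {fst r} {} c D (verts H) E" "E \<subseteq> edges H" "c + card (verts H) \<le> card ?V"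
    using builds.start[of "{fst r}" "{}"] f r unfolding m_def fstV by auto
  \<comment> \<open>Edges of \<open>H\<close> met by no projected ear are added for free.\<close>
  have "builds {fst r} {} c D (verts H) (E \<union> edges H)"
    by (rule builds_add_edges[OF b1(1) simple_graph_finite_edges[OF H(1)]])
      (use H(1) in \<open>auto simp: simple_graph_def\<close>)
  moreover have "E \<union> edges H = edges H" using b1(2) by blast
  moreover have "card ?V = (\<Sum>v\<in>verts H. b v)"
    unfolding V using H(1) by (simp add: simple_graph_def)
  ultimately show ?thesis using that b1(3) by metis
qed

section \<open>From builds to factor-critical replications\<close>

text \<open>Only the covered vertex set is recorded, so matchings combine as disjoint unions of
  sets; \<open>matchable_matching\<close> recovers the edges.\<close>

inductive matchable :: "'a set set \<Rightarrow> 'a set \<Rightarrow> bool" for E where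
  empty: "matchable E {}"
| pair: "matchable E X \<Longrightarrow> {x, y} \<in> E \<Longrightarrow> x \<noteq> y \<Longrightarrow> x \<notin> X \<Longrightarrow> y \<notin> X \<Longrightarrow>
    matchable E (insert x (insert y X))"

lemma matchable_mono: "matchable E X \<Longrightarrow> E \<subseteq> F \<Longrightarrow> matchable F X"
  by (induction rule: matchable.induct) (auto intro: matchable.intros)

lemma matchable_Un: "matchable E X \<Longrightarrow> matchable E Y \<Longrightarrow> X \<inter> Y = {} \<Longrightarrow> matchable E (X \<union> Y)"
  by (induction rule: matchable.induct) (auto intro!: matchable.pair)

lemma matchable_walk: "distinct xs \<Longrightarrow> even (length xs) \<Longrightarrow> wE xs \<subseteq> E \<Longrightarrow> matchable E (set xs)"
proof (induction xs rule: induct_list012)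
  case (3 x y xs)
  then have "matchable E (set xs)" by (cases xs) auto
  then show ?case using 3 by (auto intro!: matchable.pair)
qed (auto intro: matchable.empty)

lemma matchable_matching:
  "matchable E X \<Longrightarrow> \<exists>M. M \<subseteq> E \<and> (\<forall>e \<in> M. \<forall>f \<in> M. e \<noteq> f \<longrightarrow> e \<inter> f = {}) \<and> \<Union>M = X"
proof (induction rule: matchable.induct)
  case (pair X x y)
  then obtain M where "M \<subseteq> E" "\<forall>e \<in> M. \<forall>f \<in> M. e \<noteq> f \<longrightarrow> e \<inter> f = {}" "\<Union>M = X" by blast
  then show ?case using pair by (intro exI[of _ "insert {x, y} M"]) auto
qed auto

definition near_matchable :: "'a set \<Rightarrow> 'a set set \<Rightarrow> bool" where
  "near_matchable V E \<longleftrightarrow> (\<forall>v \<in> V. matchable E (V - {v}))"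

lemma near_matchable_factor_critical: "near_matchable (verts G) (edges G) \<Longrightarrow> factor_critical G"
  unfolding factor_critical_def
proof
  fix v assume "near_matchable (verts G) (edges G)" "v \<in> verts G"
  then obtain M where M: "M \<subseteq> edges G" "\<forall>e \<in> M. \<forall>f \<in> M. e \<noteq> f \<longrightarrow> e \<inter> f = {}" "\<Union>M = verts G - {v}"
    unfolding near_matchable_def using matchable_matching by metis
  then show "\<exists>M. perfect_matching (delete_vertex G v) M"
    unfolding perfect_matching_def matching_def delete_vertex_def induced_def
    by (intro exI[of _ M]) auto
qed

text \<open>If the missing vertex is old, the inner vertices are matched along the ear. If it is
  inner, exactly one of the two remaining pieces has odd length; it borrows its end \<open>a\<close>
  or \<open>b\<close>, and the rest of \<open>V\<close> is matched because \<open>V\<close> is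
  near-matchable.\<close>

lemma near_matchable_ear:
  assumes nm: "near_matchable V E" and E: "E \<subseteq> E'" "wE (a # zs @ [b]) \<subseteq> E'"
    and zs: "distinct zs" "set zs \<inter> V = {}" "even (length zs)" and ab: "a \<in> V" "b \<in> V"
  shows "near_matchable (V \<union> set zs) E'"
  unfolding near_matchable_def
proof
  fix x assume x: "x \<in> V \<union> set zs"
  have del: "matchable E' (V - {v})" if "v \<in> V" for v
    using nm that matchable_mono[OF _ E(1)] unfolding near_matchable_def by blast
  show "matchable E' (V \<union> set zs - {x})"
  proof (cases "x \<in> V")
    case True
    have "wE zs \<subseteq> wE (a # zs @ [b])"
      by (cases "zs = []") (auto simp: walk_edges_Cons wE_append)
    then have "matchable E' (set zs)" using E zs by (intro matchable_walk) auto
    then have "matchable E' ((V - {x}) \<union> set zs)" using del[OF True] zs by (intro matchable_Un) auto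
    moreover have "(V - {x}) \<union> set zs = V \<union> set zs - {x}" using True zs(2) by auto
    ultimately show ?thesis by simp
  next
    case False
    then obtain us vs where s: "zs = us @ x # vs" using x by (meson UnE split_list)
    have W: "wE (a # us) \<subseteq> E'" "wE (vs @ [b]) \<subseteq> E'"
    proof -
      have "wE (a # us) \<subseteq> wE (a # us @ [x])" using wE_append[of "a # us" "[x]"] by auto
      moreover have "wE (vs @ [b]) \<subseteq> wE (x # vs @ [b])" by (auto simp: walk_edges_Cons)
      ultimately show "wE (a # us) \<subseteq> E'" "wE (vs @ [b]) \<subseteq> E'"
        using E(2) wE_ear_split[of a us x vs b] unfolding s by auto
    qed
    show ?thesis
    proof (cases "even (length us)")
      case True
      have "wE us \<subseteq> wE (a # us)" by (cases "us = []") (auto simp: walk_edges_Cons)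
      then have 1: "matchable E' (set us)" using True W zs s by (intro matchable_walk) auto
      have 2: "matchable E' (set (vs @ [b]))" using True W zs s ab by (intro matchable_walk) auto
      have "matchable E' (set us \<union> (set (vs @ [b]) \<union> (V - {b})))"
        by (intro matchable_Un 1 2 del[OF ab(2)]) (use zs s ab in auto)
      moreover have "set us \<union> (set (vs @ [b]) \<union> (V - {b})) = V \<union> set zs - {x}"
        using zs s ab by auto
      ultimately show ?thesis by simp
    next
      case False
      have "wE vs \<subseteq> wE (vs @ [b])" by (cases "vs = []") (auto simp: wE_append)
      then have 1: "matchable E' (set vs)" using False W zs s by (intro matchable_walk) auto
      have 2: "matchable E' (set (a # us))" using False W zs s ab by (intro matchable_walk) auto
      have "matchable E' (set vs \<union> (set (a # us) \<union> (V - {a})))"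
        by (intro matchable_Un 1 2 del[OF ab(1)]) (use zs s ab in auto)
      moreover have "set vs \<union> (set (a # us) \<union> (V - {a})) = V \<union> set zs - {x}"
        using zs s ab by auto
      ultimately show ?thesis by simp
    qed
  qed
qed

definition copies :: "('a \<Rightarrow> nat) \<Rightarrow> 'a set \<Rightarrow> ('a \<times> nat) set" where
  "copies b V = (SIGMA v:V. {1..b v})"

definition copy_edges :: "('a \<Rightarrow> nat) \<Rightarrow> 'a set set \<Rightarrow> ('a \<times> nat) set set" where
  "copy_edges b E =
     {{(u, l), (v, m)} | u l v m. {u, v} \<in> E \<and> l \<in> {1..b u} \<and> m \<in> {1..b v}}"

lemma replication_eq: "replication b G = Graph (copies b (verts G)) (copy_edges b (edges G))"
  unfolding replication_def copies_def copy_edges_def by simp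

lemma copy_edges_mono: "E \<subseteq> F \<Longrightarrow> b \<le> b' \<Longrightarrow> copy_edges b E \<subseteq> copy_edges b' F"
proof
  fix e assume "E \<subseteq> F" "b \<le> b'" "e \<in> copy_edges b E"
  then obtain u l v m where e: "e = {(u, l), (v, m)}" "{u, v} \<in> F" "l \<in> {1..b u}" "m \<in> {1..b v}"
    unfolding copy_edges_def by blast
  have "b u \<le> b' u" "b v \<le> b' v" using \<open>b \<le> b'\<close> by (simp_all add: le_fun_def)
  then have "l \<in> {1..b' u}" "m \<in> {1..b' v}" using e(3,4) by auto
  then show "e \<in> copy_edges b' F" using e(1,2) unfolding copy_edges_def by blast
qed

lemma copy_edgesI: "{u, v} \<in> E \<Longrightarrow> l \<in> {1..b u} \<Longrightarrow> m \<in> {1..b v} \<Longrightarrow> {(u, l), (v, m)} \<in> copy_edges b E"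
  unfolding copy_edges_def by blast

lemma walk_first_copies:
  assumes "wE xs \<subseteq> E" "\<And>v. b v \<ge> 1"
  shows "wE (map (\<lambda>v. (v, 1)) xs) \<subseteq> copy_edges b E"
  using assms(1)
proof (induction xs rule: walk_edges.induct)
  case (1 x y xs)
  then show ?case using assms(2) by (auto intro!: copy_edgesI simp: Suc_le_eq)
qed auto

text \<open>The copies outside \<open>V\<close> are fixed to one so that a later ear can use them unchanged.\<close>

definition critical_copies :: "'a set \<Rightarrow> 'a set set \<Rightarrow> nat \<Rightarrow> bool" where
  "critical_copies V E c \<longleftrightarrow> (\<exists>b :: 'a \<Rightarrow> nat. (\<forall>v. b v \<ge> 1) \<and> (\<forall>v. v \<notin> V \<longrightarrow> b v = 1) \<and>
     near_matchable (copies b V) (copy_edges b E) \<and> (\<Sum>v\<in>V. b v) \<le> card V + c)"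

lemma critical_copies_mono:
  assumes "critical_copies V E c" "c \<le> c'"
  shows "critical_copies V E c'"
proof -
  have "card V + c \<le> card V + c'" using assms(2) by simp
  then show ?thesis using assms(1) unfolding critical_copies_def by (meson order_trans)
qed

text \<open>An ear with an even number of edges is made odd by ending it in a new copy of its end vertex,
  followed by a neighbour of that vertex.\<close>

lemma critical_copies_ear:
  assumes cc: "critical_copies V E c" and fin: "finite V" and ab: "a \<in> V" "e \<in> V"
    and zs: "distinct zs" "set zs \<inter> V = {}"
    and nb: "odd (length zs) \<Longrightarrow> \<exists>w \<in> V. {e, w} \<in> E"
  shows "critical_copies (V \<union> set zs) (E \<union> wE (a # zs @ [e])) (c + length zs mod 2)"
proof -
  let ?E = "E \<union> wE (a # zs @ [e])"
  obtain b where b: "\<And>v. b v \<ge> 1" "\<And>v. v \<notin> V \<Longrightarrow> b v = 1"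
    "near_matchable (copies b V) (copy_edges b E)" "(\<Sum>v\<in>V. b v) \<le> card V + c"
    using cc unfolding critical_copies_def by blast
  have card: "card (V \<union> set zs) = card V + length zs"
    using zs fin by (subst card_Un_disjoint) (auto simp: distinct_card)
  have "(\<Sum>v\<in>set zs. b v) = (\<Sum>v\<in>set zs. 1)"
    by (rule sum.cong) (use b(2) zs(2) in auto)
  then have sum: "(\<Sum>v\<in>V \<union> set zs. b v) \<le> card V + c + length zs"
    using zs fin b(4) by (subst sum.union_disjoint) (auto simp: distinct_card Int_commute)
  let ?zs = "map (\<lambda>v. (v, 1::nat)) zs"
  have ab': "(a, 1) \<in> copies b V" "(v, 1) \<in> copies b V" if "v \<in> V" for v
    using ab that b(1) by (auto simp: copies_def Suc_le_eq)
  have copies: "copies b (V \<union> set zs) = copies b V \<union> set ?zs"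
    using b(2) zs(2) by (force simp: copies_def)
  show ?thesis
  proof (cases "even (length zs)")
    case True
    have "wE (map (\<lambda>v. (v, 1)) (a # zs @ [e])) \<subseteq> copy_edges b ?E"
      by (rule walk_first_copies) (use b(1) in auto)
    then have "near_matchable (copies b V \<union> set ?zs) (copy_edges b ?E)"
      by (intro near_matchable_ear[OF b(3) copy_edges_mono, of _ _ "(a, 1)" _ "(e, 1)"])
        (use True zs ab' ab in \<open>auto simp: distinct_map inj_on_def copies_def\<close>)
    then show ?thesis unfolding critical_copies_def copies[symmetric]
      using b sum card True by (intro exI[of _ b]) auto
  next
    case False
    then obtain w where w: "w \<in> V" "{e, w} \<in> E" using nb by blast
    define b' where "b' = b(e := b e + 1)"
    \<comment> \<open>The index \<open>b e + 1\<close> lies just beyond the old copies of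
      \<open>e\<close>, and this one extra vertex turns the odd \<open>length zs\<close> into an
      even length.\<close>
    define ys where "ys = ?zs @ [(e, b e + 1)]"
    have b'1: "b' v \<ge> 1" for v using b(1) by (simp add: b'_def)
    have le: "b \<le> b'" by (simp add: b'_def le_fun_def)
    have copies': "copies b' (V \<union> set zs) = copies b V \<union> set ys"
    proof -
      have "copies b' (V \<union> set zs) = copies b (V \<union> set zs) \<union> {(e, b e + 1)}"
        using ab by (auto simp: copies_def b'_def le_Suc_eq split: if_splits)
      then show ?thesis unfolding copies ys_def by auto
    qed
    have walk: "wE ((a, 1) # ys @ [(w, 1)]) \<subseteq> copy_edges b' ?E"
    proof -
      have eq: "(a, 1) # ys @ [(w, 1)] = map (\<lambda>v. (v, 1)) (a # zs) @ [(e, b e + 1), (w, 1)]"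
        by (simp add: ys_def)
      have "wE (a # zs) \<subseteq> ?E" "{last (a # zs), e} \<in> ?E"
        using wE_append[of "a # zs" "[e]"] by auto
      moreover from this(1) have "wE (map (\<lambda>v. (v, 1)) (a # zs)) \<subseteq> copy_edges b' ?E"
        by (rule walk_first_copies[OF _ b'1])
      moreover have "{(last (a # zs), 1), (e, b e + 1)} \<in> copy_edges b' ?E"
        using calculation(2) b'1[of "last (a # zs)"]
        by (intro copy_edgesI) (simp_all add: b'_def)
      moreover have "{(e, b e + 1), (w, 1)} \<in> copy_edges b' ?E"
        using w(2) b'1[of w] by (intro copy_edgesI) (simp_all add: b'_def)
      moreover have "last (map (\<lambda>v. (v, 1::nat)) (a # zs)) = (last (a # zs), 1)"
        by (rule last_map) simp
      ultimately show ?thesis unfolding eq by (subst wE_append) auto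
    qed
    have "near_matchable (copies b V \<union> set ys) (copy_edges b' ?E)"
    proof (rule near_matchable_ear[OF b(3) _ walk])
      show "copy_edges b E \<subseteq> copy_edges b' ?E" by (rule copy_edges_mono) (use le in auto)
      show "distinct ys" "set ys \<inter> copies b V = {}"
        using zs ab by (auto simp: ys_def distinct_map inj_on_def copies_def)
    qed (use False ab' ab w in \<open>auto simp: ys_def\<close>)
    moreover have "(\<Sum>v\<in>V \<union> set zs. b' v) = (\<Sum>v\<in>V \<union> set zs. b v) + 1"
    proof -
      have "(\<Sum>v\<in>V \<union> set zs. b' v) = b' e + (\<Sum>v\<in>V \<union> set zs - {e}. b' v)"
        by (rule sum.remove) (use fin ab in auto)
      also have "(\<Sum>v\<in>V \<union> set zs - {e}. b' v) = (\<Sum>v\<in>V \<union> set zs - {e}. b v)"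
        by (rule sum.cong) (auto simp: b'_def)
      also have "b' e + \<dots> = (\<Sum>v\<in>V \<union> set zs. b v) + 1"
        by (subst sum.remove[of "V \<union> set zs" e b]) (use fin ab in \<open>auto simp: b'_def\<close>)
      finally show ?thesis .
    qed
    moreover have "b' v = 1" if "v \<notin> V \<union> set zs" for v using that ab b(2) by (auto simp: b'_def)
    ultimately show ?thesis unfolding critical_copies_def copies'[symmetric]
      using b'1 sum card False
      by (intro exI[of _ b']) (auto simp: odd_iff_mod_2_eq_one)
  qed
qed

text \<open>Provides the neighbour next to which \<open>critical_copies_ear\<close> attaches a new
  copy of the end vertex; it must be present before the ear is added.\<close>

definition no_isolated :: "'a set \<Rightarrow> 'a set set \<Rightarrow> bool" where
  "no_isolated V E \<longleftrightarrow> (\<forall>v \<in> V. \<exists>w \<in> V. {v, w} \<in> E)"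

lemma walk_inner_neighbour: "x \<in> set zs \<Longrightarrow> \<exists>w \<in> set (a # zs). {x, w} \<in> wE (a # zs @ [b])"
proof (induction zs arbitrary: a)
  case (Cons z zs)
  show ?case
  proof (cases "x = z")
    case False
    then show ?thesis using Cons.IH[of z] Cons.prems by auto
  qed (auto simp: insert_commute)
qed simp

lemma no_isolated_ear:
  assumes "no_isolated V E" "a \<in> V"
  shows "no_isolated (V \<union> set zs) (E \<union> wE (a # zs @ [b]))"
  using assms walk_inner_neighbour[of _ zs a b] unfolding no_isolated_def by fastforce

lemma critical_copies_builds:
  assumes "builds V0 E0 c D V E" "critical_copies V0 E0 c0" "finite V0" "no_isolated V0 E0"
  shows "critical_copies V E (c0 + c) \<and> no_isolated V E"
  using assms
proof (induction rule: builds.induct)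
  case (ear c D V E a b zs)
  have IH: "critical_copies V E (c0 + c)" "no_isolated V E" using ear by auto
  have "critical_copies (V \<union> set zs) (E \<union> wE (a # zs @ [b])) (c0 + c + length zs mod 2)"
    by (rule critical_copies_ear[OF IH(1) builds_finite[OF ear.hyps(1)]])
      (use ear IH(2) in \<open>auto simp: no_isolated_def\<close>)
  then show ?case using no_isolated_ear[OF IH(2) ear.hyps(2)] by (simp add: add.assoc)
qed simp

lemma critical_copies_single: "critical_copies {a} {} 0"
proof -
  have "near_matchable (copies (\<lambda>_. 1) {a}) (copy_edges (\<lambda>_. 1) {})"
    unfolding near_matchable_def copies_def by (auto intro: matchable.empty)
  then show ?thesis unfolding critical_copies_def by (intro exI[of _ "\<lambda>_. 1"]) auto
qed

section \<open>Two-colourings and the first odd cycle\<close>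

definition proper_colouring :: "('a \<Rightarrow> bool) \<Rightarrow> 'a set set \<Rightarrow> bool" where
  "proper_colouring \<chi> E \<longleftrightarrow> (\<forall>e \<in> E. \<exists>u v. e = {u, v} \<and> \<chi> u \<noteq> \<chi> v)"

lemma proper_colouring_edge: "proper_colouring \<chi> E \<Longrightarrow> {u, v} \<in> E \<Longrightarrow> \<chi> u \<noteq> \<chi> v"
  unfolding proper_colouring_def by (metis doubleton_eq_iff)

lemma proper_colouring_walk:
  "xs \<noteq> [] \<Longrightarrow> proper_colouring \<chi> E \<Longrightarrow> wE xs \<subseteq> E \<Longrightarrow>
    \<chi> (hd xs) = \<chi> (last xs) \<longleftrightarrow> odd (length xs)"
proof (induction xs rule: walk_edges.induct)
  case (1 x y xs)
  have "\<chi> x \<noteq> \<chi> y" using 1 proper_colouring_edge[of \<chi> E x y] by auto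
  moreover have "\<chi> y = \<chi> (last (y # xs)) \<longleftrightarrow> odd (length (y # xs))" using 1 by auto
  ultimately show ?case by auto
qed auto

text \<open>The inner colours are forced by alternation from \<open>a\<close>; the parity condition
  says that they then fit the colour of \<open>b\<close>.\<close>

lemma colour_ear:
  assumes "distinct zs" "a \<notin> set zs" "b \<notin> set zs" "\<chi> a = \<chi> b \<longleftrightarrow> odd (length zs)"
  shows "\<exists>\<chi>'. (\<forall>v. v \<notin> set zs \<longrightarrow> \<chi>' v = \<chi> v) \<and> proper_colouring \<chi>' (wE (a # zs @ [b]))"
  using assms
proof (induction zs arbitrary: a \<chi>)
  case Nil
  then show ?case unfolding proper_colouring_def by auto
next
  case (Cons z zs)
  let ?\<chi> = "\<chi>(z := \<not> \<chi> a)"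
  obtain \<chi>' where \<chi>': "\<forall>v. v \<notin> set zs \<longrightarrow> \<chi>' v = ?\<chi> v" "proper_colouring \<chi>' (wE (z # zs @ [b]))"
    using Cons.IH[of z ?\<chi>] Cons.prems by auto
  then have "\<chi>' a = \<chi> a" "\<chi>' z = (\<not> \<chi> a)" using Cons.prems by auto
  then have "proper_colouring \<chi>' (insert {a, z} (wE (z # zs @ [b])))"
    using \<chi>'(2) unfolding proper_colouring_def by blast
  then show ?case using \<chi>'(1) by (intro exI[of _ \<chi>']) auto
qed

lemma proper_colouring_cong:
  assumes "proper_colouring \<chi> E" "E \<subseteq> Pow V" "\<And>v. v \<in> V \<Longrightarrow> \<chi>' v = \<chi> v"
  shows "proper_colouring \<chi>' E"
  unfolding proper_colouring_def
proof
  fix e assume e: "e \<in> E"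
  then obtain u v where "e = {u, v}" "\<chi> u \<noteq> \<chi> v" using assms(1) unfolding proper_colouring_def by blast
  then show "\<exists>u v. e = {u, v} \<and> \<chi>' u \<noteq> \<chi>' v"
    using e assms(2,3) by (intro exI[of _ u] exI[of _ v]) auto
qed

text \<open>The first ear that destroys bipartiteness closes an odd cycle with any path between its ends,
  in particular with one from which the earlier graph can be rebuilt at no extra cost.\<close>

lemma builds_bipartite_or_critical:
  assumes "builds {r} {} c D V E"
  shows "(\<exists>\<chi>. proper_colouring \<chi> E) \<or> critical_copies V E c \<and> no_isolated V E"
  using assms
proof (induction rule: builds.induct)
  case start
  then show ?case by (auto simp: proper_colouring_def)
next
  case (ear c D V E a b zs)
  let ?c = "c + length zs mod 2" and ?V = "V \<union> set zs" and ?E = "E \<union> wE (a # zs @ [b])"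
  have sub: "E \<subseteq> Pow V" and fin: "finite V"
    using builds_edges_within[OF ear.hyps(1)] builds_finite[OF ear.hyps(1)] by auto
  from ear.IH show ?case
  proof
    assume IH: "critical_copies V E c \<and> no_isolated V E"
    then have "critical_copies ?V ?E ?c"
      by (intro critical_copies_ear) (use ear fin in \<open>auto simp: no_isolated_def\<close>)
    then show ?thesis using no_isolated_ear[of V E a zs b] IH ear.hyps(2) by simp
  next
    assume "\<exists>\<chi>. proper_colouring \<chi> E"
    then obtain \<chi> where \<chi>: "proper_colouring \<chi> E" by blast
    have notin: "a \<notin> set zs" "b \<notin> set zs" using ear.hyps by auto
    show ?thesis
    proof (cases "\<chi> a = \<chi> b \<longleftrightarrow> odd (length zs)")
      case True
      then obtain \<chi>' where \<chi>': "\<forall>v. v \<notin> set zs \<longrightarrow> \<chi>' v = \<chi> v" "proper_colouring \<chi>' (wE (a # zs @ [b]))"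
        using colour_ear[OF ear.hyps(4) notin] by blast
      have "proper_colouring \<chi>' E"
        by (rule proper_colouring_cong[OF \<chi> sub]) (use \<chi>'(1) ear.hyps(5) in auto)
      then have "proper_colouring \<chi>' ?E" using \<chi>'(2) unfolding proper_colouring_def by blast
      then show ?thesis by blast
    next
      case False
      show ?thesis
        using builds_along_path[OF ear.hyps(1-3)]
      proof (rule path_buildE)
        fix ps c' D'
        assume ps: "ps \<noteq> []" "hd ps = a" "last ps = b" "distinct ps"
          "builds (set ps) (wE ps) c' D' V E" and c': "c' + (length ps + 1) mod 2 \<le> c"
        have psV: "set ps \<subseteq> V" "wE ps \<subseteq> E" using builds_mono[OF ps(5)] by auto
        then have "\<chi> a = \<chi> b \<longleftrightarrow> odd (length ps)"
          using proper_colouring_walk[OF ps(1) \<chi>] ps(2,3) by auto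
        \<comment> \<open>The colouring fixes the parity of every old path from \<open>a\<close> to
          \<open>b\<close>, so whichever path the exchange returns closes up with the ear to an odd
          cycle.\<close>
        then have par: "even (length ps + length zs + 1)" using False by auto
        define ys where "ys = tl ps @ rev zs"
        have ps': "ps = a # tl ps" using ps(1,2) by (cases ps) auto
        have ysE: "wE (a # ys @ [a]) = wE ps \<union> wE (a # zs @ [b])"
          using wE_join[of ps "[]" "rev zs @ [a]"] ps ps' wE_ear_rev[of b zs a]
          by (simp add: ys_def) (metis append_Cons)
        have "length ps = length (tl ps) + 1" by (subst ps') simp
        then have "even (length ys)" using par by (simp add: ys_def)
        have dist: "distinct ys" "a \<notin> set ys"
        proof -
          have "distinct (a # tl ps)" using ps(4) ps' by simp
          moreover have "set (tl ps) \<subseteq> V" using psV(1) by (cases ps) auto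
          ultimately show "distinct ys" "a \<notin> set ys"
            using ear.hyps(2,4,5) by (auto simp: ys_def)
        qed
        have ysV: "{a} \<union> set ys = set ps \<union> set zs"
          unfolding ys_def by (subst (2) ps') auto
        \<comment> \<open>The cycle is an odd closed ear at the single vertex \<open>a\<close>, so
          it calls for no additional copy.\<close>
        have "critical_copies ({a} \<union> set ys) ({} \<union> wE (a # ys @ [a])) (0 + length ys mod 2)"
          by (rule critical_copies_ear[OF critical_copies_single])
            (use dist \<open>even (length ys)\<close> in auto)
        then have cc: "critical_copies (set ps \<union> set zs) (wE ps \<union> wE (a # zs @ [b])) 0"
          using \<open>even (length ys)\<close> ysV ysE by simp
        have ni: "no_isolated (set ps \<union> set zs) (wE ps \<union> wE (a # zs @ [b]))"
        proof -
          have "ys \<noteq> []"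
          proof
            assume "ys = []"
            then have "zs = []" "tl ps = []" by (auto simp: ys_def)
            then have "zs = []" "ps = [a]" using ps' by simp_all
            then show False using ear.hyps(6) ps(3) by simp
          qed
          then have "{a, hd ys} \<in> wE (a # ys @ [a])" "hd ys \<in> set ys"
            by (auto simp: walk_edges_Cons)
          then have "no_isolated ({a} \<union> set ys) (wE (a # ys @ [a]))"
            using walk_inner_neighbour[of _ ys a a] unfolding no_isolated_def by auto
          then show ?thesis unfolding ysV ysE .
        qed
        \<comment> \<open>The old graph is rebuilt with the whole cycle as its start, which already
          contains the new ear.\<close>
        have "builds (set ps \<union> set zs) (wE ps \<union> wE (a # zs @ [b])) c' D'
            (V \<union> (set ps \<union> set zs)) (E \<union> (wE ps \<union> wE (a # zs @ [b])))"
          by (rule builds_extend[OF ps(5)]) (use ear.hyps(5) in auto)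
        moreover have "V \<union> (set ps \<union> set zs) = ?V" "E \<union> (wE ps \<union> wE (a # zs @ [b])) = ?E"
          using psV by auto
        ultimately have "critical_copies ?V ?E (0 + c') \<and> no_isolated ?V ?E"
          using critical_copies_builds[OF _ cc _ ni] by auto
        moreover have "c' \<le> ?c" using c' by linarith
        ultimately show ?thesis using critical_copies_mono[of ?V ?E c' ?c] by simp
      qed
    qed
  qed
qed

theorem builds_factor_critical_replication:
  assumes "builds {r} {} c D (verts H) (edges H)" "\<not> bipartite H"
  obtains b where "\<And>v. b v \<ge> 1" "factor_critical (replication b H)"
    "(\<Sum>v\<in>verts H. b v) \<le> card (verts H) + c"
proof -
  have sub: "edges H \<subseteq> Pow (verts H)" using builds_edges_within[OF assms(1)] by simp
  have "\<not> proper_colouring \<chi> (edges H)" for \<chi>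
  proof
    assume \<chi>: "proper_colouring \<chi> (edges H)"
    have "\<forall>e \<in> edges H. e \<inter> {v \<in> verts H. \<chi> v} \<noteq> {} \<and> e \<inter> {v \<in> verts H. \<not> \<chi> v} \<noteq> {}"
    proof
      fix e assume e: "e \<in> edges H"
      then obtain u v where uv: "e = {u, v}" "\<chi> u \<noteq> \<chi> v"
        using \<chi> unfolding proper_colouring_def by blast
      then have "u \<in> verts H" "v \<in> verts H" using e sub by auto
      then show "e \<inter> {v \<in> verts H. \<chi> v} \<noteq> {} \<and> e \<inter> {v \<in> verts H. \<not> \<chi> v} \<noteq> {}"
        using uv by blast
    qed
    moreover have "{v \<in> verts H. \<chi> v} \<union> {v \<in> verts H. \<not> \<chi> v} = verts H"
      "{v \<in> verts H. \<chi> v} \<inter> {v \<in> verts H. \<not> \<chi> v} = {}" by blast+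
    ultimately have "bipartite H" unfolding bipartite_def by blast
    then show False using assms(2) by contradiction
  qed
  then have "critical_copies (verts H) (edges H) c"
    using builds_bipartite_or_critical[OF assms(1)] by blast
  then obtain b :: "'a \<Rightarrow> nat" where "\<And>v. b v \<ge> 1"
    "near_matchable (copies b (verts H)) (copy_edges b (edges H))"
    "(\<Sum>v\<in>verts H. b v) \<le> card (verts H) + c"
    unfolding critical_copies_def by blast
  moreover from this(2) have "factor_critical (replication b H)"
    by (intro near_matchable_factor_critical) (simp add: replication_eq)
  ultimately show ?thesis using that by blast
qed

section \<open>Disjoint unions\<close>

lemma simple_edge: "simple_graph G \<Longrightarrow> {u, v} \<in> edges G \<Longrightarrow> u \<in> verts G \<and> v \<in> verts G \<and> u \<noteq> v"
  unfolding simple_graph_def by (cases "u = v") fastforce+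

lemma simple_edge_nonempty: "simple_graph G \<Longrightarrow> e \<in> edges G \<Longrightarrow> e \<noteq> {} \<and> e \<subseteq> verts G"
  unfolding simple_graph_def by fastforce

lemma connected_neighbour:
  assumes "simple_graph H" "connected_graph H" "edges H \<noteq> {}" "u \<in> verts H"
  shows "\<exists>w. {u, w} \<in> edges H"
proof -
  obtain e where e: "e \<in> edges H" using assms(3) by blast
  then have "card e = 2" "e \<subseteq> verts H" using assms(1) unfolding simple_graph_def by auto
  then obtain p q where pq: "e = {p, q}" "p \<noteq> q" "p \<in> verts H" "q \<in> verts H"
    by (auto simp: card_2_iff)
  obtain x where x: "x \<in> verts H" "x \<noteq> u" using pq(2-4) by (cases "p = u") auto
  then have "(u, x) \<in> {(x, y). {x, y} \<in> edges H}\<^sup>*"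
    using assms(2,4) unfolding connected_graph_def reachable_def by blast
  then show ?thesis
  proof (cases rule: converse_rtranclE)
    case (step w)
    then show ?thesis by blast
  qed (use x(2) in simp)
qed

text \<open>Walks with at least one edge are wanted because two copies of the same vertex are joined
  by going to a neighbour and back.\<close>

lemma connected_trancl:
  assumes "simple_graph H" "connected_graph H" "edges H \<noteq> {}" "u \<in> verts H" "v \<in> verts H"
  shows "(u, v) \<in> (adj (edges H))\<^sup>+"
proof -
  have "(u, v) \<in> (adj (edges H))\<^sup>*"
    using assms unfolding connected_graph_def reachable_def adj_def by blast
  moreover obtain w where "{u, w} \<in> edges H" using connected_neighbour[OF assms(1-4)] by blast
  then have "(u, w) \<in> adj (edges H)" "(w, u) \<in> adj (edges H)" by (auto simp: adj_def insert_commute)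
  then have "(u, u) \<in> (adj (edges H))\<^sup>+" by (rule trancl.trancl_into_trancl[OF r_into_trancl])
  ultimately show ?thesis by (metis rtranclD)
qed

lemma connected_replication:
  assumes "simple_graph H" "connected_graph H" "edges H \<noteq> {}" "\<And>v. b v \<ge> 1"
    and "x \<in> verts (replication b H)" "y \<in> verts (replication b H)"
  shows "(x, y) \<in> (adj (edges (replication b H)))\<^sup>*"
proof -
  have edge: "((u, l), (v, m)) \<in> adj (edges (replication b H))"
    if "(u, v) \<in> adj (edges H)" "l \<in> {1..b u}" "m \<in> {1..b v}" for u v l m
    using that unfolding adj_def replication_eq by (auto intro!: copy_edgesI)
  have walk: "((u, l), (v, m)) \<in> (adj (edges (replication b H)))\<^sup>*"
    if "(u, v) \<in> (adj (edges H))\<^sup>+" "l \<in> {1..b u}" "m \<in> {1..b v}" for u v l m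
    using that
  proof (induction arbitrary: m rule: trancl_induct)
    case (base v)
    then show ?case using edge by blast
  next
    case (step v w)
    then have "((u, l), (v, 1)) \<in> (adj (edges (replication b H)))\<^sup>*" using assms(4) by simp
    moreover have "((v, 1), (w, m)) \<in> adj (edges (replication b H))" using step edge assms(4) by simp
    ultimately show ?case by (rule rtrancl_into_rtrancl)
  qed
  show ?thesis using assms(5,6) walk connected_trancl[OF assms(1-3)]
    by (cases x; cases y) (auto simp: replication_def)
qed

lemma disjoint_union_edge:
  assumes "disjoint_union_of t K P" "\<And>i. i \<in> {1..t} \<Longrightarrow> simple_graph (K i)" "i \<in> {1..t}"
    and "e \<in> edges P" "e \<inter> verts (K i) \<noteq> {}"
  shows "e \<in> edges (K i)"
proof -
  obtain j where j: "j \<in> {1..t}" "e \<in> edges (K j)"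
    using assms(1,4) unfolding disjoint_union_of_def graph_Union_def by auto
  then have "e \<subseteq> verts (K j)" using simple_edge_nonempty[OF assms(2)] by blast
  then have "verts (K i) \<inter> verts (K j) \<noteq> {}" using assms(5) by blast
  then have "i = j" using assms(1,3) j(1) unfolding disjoint_union_of_def by blast
  then show ?thesis using j by simp
qed

lemma disjoint_union_reach:
  assumes "disjoint_union_of t K P" "\<And>i. i \<in> {1..t} \<Longrightarrow> simple_graph (K i)" "i \<in> {1..t}"
    and "(u, v) \<in> (adj (edges P))\<^sup>*" "u \<in> verts (K i)"
  shows "v \<in> verts (K i)"
  using assms(4,5)
proof (induction rule: rtrancl_induct)
  case (step x y)
  then have "{x, y} \<in> edges (K i)"
    by (intro disjoint_union_edge[OF assms(1-3)]) (auto simp: adj_def)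
  then show ?case using simple_edge[OF assms(2)[OF assms(3)]] by blast
qed

lemma disjoint_union_verts:
  "disjoint_union_of t K P \<Longrightarrow> verts P = (\<Union>i\<in>{1..t}. verts (K i))"
  "disjoint_union_of t K P \<Longrightarrow> edges P = (\<Union>i\<in>{1..t}. edges (K i))"
  unfolding disjoint_union_of_def graph_Union_def by auto

lemma disjoint_union_disjoint:
  "disjoint_union_of t K P \<Longrightarrow> i \<in> {1..t} \<Longrightarrow> j \<in> {1..t} \<Longrightarrow> x \<in> verts (K i) \<Longrightarrow>
    x \<in> verts (K j) \<Longrightarrow> i = j"
  unfolding disjoint_union_of_def by blast

lemma disjoint_union_sum:
  assumes "disjoint_union_of t K P" "\<And>i. i \<in> {1..t} \<Longrightarrow> simple_graph (K i)"
  shows "(\<Sum>v\<in>verts P. f v) = (\<Sum>i\<in>{1..t}. \<Sum>v\<in>verts (K i). f v)"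
  unfolding disjoint_union_verts[OF assms(1)]
  by (rule sum.UNION_disjoint)
    (use assms in \<open>auto simp: simple_graph_def disjoint_union_of_def\<close>)

text \<open>The partition \<open>L\<close> that witnesses matching-criticality is unrelated to
  \<open>K\<close>, but connectivity places all of \<open>K i\<close> in the part of
  \<open>L\<close> containing \<open>v\<close>. Edges of \<open>P\<close> meeting \<open>K i\<close>
  stay inside it, so the matching of that part restricts to one of \<open>K i\<close> without
  \<open>v\<close>.\<close>

lemma factor_critical_of_matching_critical:
  assumes K: "disjoint_union_of t K P" "\<And>i. i \<in> {1..t} \<Longrightarrow> simple_graph (K i)" "i \<in> {1..t}"
    and conn: "\<And>x y. x \<in> verts (K i) \<Longrightarrow> y \<in> verts (K i) \<Longrightarrow> (x, y) \<in> (adj (edges (K i)))\<^sup>*"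
    and mc: "matching_critical P"
  shows "factor_critical (K i)"
  unfolding factor_critical_def
proof
  fix v assume v: "v \<in> verts (K i)"
  obtain s L where L: "disjoint_union_of s L P"
    "\<And>j. j \<in> {1..s} \<Longrightarrow> simple_graph (L j)" "\<And>j. j \<in> {1..s} \<Longrightarrow> factor_critical (L j)"
    using mc unfolding matching_critical_def by blast
  have "v \<in> verts P" using v K(3) disjoint_union_verts(1)[OF K(1)] by blast
  then obtain j where j: "j \<in> {1..s}" "v \<in> verts (L j)" using disjoint_union_verts(1)[OF L(1)] by blast
  have sub: "edges (K i) \<subseteq> edges P" "edges (L j) \<subseteq> edges P"
    using K(3) j(1) disjoint_union_verts(2)[OF K(1)] disjoint_union_verts(2)[OF L(1)] by auto
  have "verts (K i) \<subseteq> verts (L j)"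
    using disjoint_union_reach[OF L(1,2) j(1) adj_rtrancl_mono[OF sub(1) conn[OF v]] j(2)] by blast
  obtain M where "perfect_matching (delete_vertex (L j) v) M"
    using L(3)[OF j(1)] j(2) unfolding factor_critical_def by blast
  then have M: "M \<subseteq> edges (L j)" "\<forall>e \<in> M. \<forall>f \<in> M. e \<noteq> f \<longrightarrow> e \<inter> f = {}" "\<Union>M = verts (L j) - {v}"
    unfolding perfect_matching_def matching_def delete_vertex_def induced_def by auto
  define N where "N = {e \<in> M. e \<inter> verts (K i) \<noteq> {}}"
  have N: "e \<in> edges (K i)" "e \<subseteq> verts (K i)" if "e \<in> N" for e
  proof -
    show "e \<in> edges (K i)"
      using that M(1) sub(2) unfolding N_def by (intro disjoint_union_edge[OF K]) auto
    then show "e \<subseteq> verts (K i)" using simple_edge_nonempty[OF K(2)[OF K(3)]] by blast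
  qed
  have "\<Union>N = verts (K i) - {v}"
  proof
    show "\<Union>N \<subseteq> verts (K i) - {v}" using N(2) M(3) unfolding N_def by blast
    show "verts (K i) - {v} \<subseteq> \<Union>N"
      using M(3) \<open>verts (K i) \<subseteq> verts (L j)\<close> unfolding N_def by blast
  qed
  moreover have "\<forall>e \<in> N. \<forall>f \<in> N. e \<noteq> f \<longrightarrow> e \<inter> f = {}" using M(2) unfolding N_def by blast
  ultimately show "\<exists>M. perfect_matching (delete_vertex (K i) v) M"
    unfolding perfect_matching_def matching_def delete_vertex_def induced_def
    using N(1) by (intro exI[of _ N]) auto
qed

section \<open>Matching numbers of disjoint unions\<close>

lemma card_Union_matching:
  assumes "finite M" "\<And>e. e \<in> M \<Longrightarrow> card e = 2" "\<forall>e \<in> M. \<forall>f \<in> M. e \<noteq> f \<longrightarrow> e \<inter> f = {}"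
  shows "card (\<Union>M) = 2 * card M"
proof -
  have "finite e" if "e \<in> M" for e using assms(2)[OF that] card.infinite by fastforce
  then have "card (\<Union>M) = sum card M"
    using assms by (intro card_Union_disjoint) (auto simp: pairwise_def disjnt_def)
  then show ?thesis using assms(2) by simp
qed

text \<open>Every part has odd order, so a matching misses a vertex of each part, while the union of
  near-perfect matchings misses exactly one in each. The additive form avoids halving and
  subtraction of naturals.\<close>

lemma matching_number_disjoint_union:
  assumes K: "disjoint_union_of t K P" "\<And>i. i \<in> {1..t} \<Longrightarrow> simple_graph (K i)"
    and ne: "\<And>i. i \<in> {1..t} \<Longrightarrow> verts (K i) \<noteq> {}"
    and fc: "\<And>i. i \<in> {1..t} \<Longrightarrow> factor_critical (K i)"
  shows "2 * matching_number P + t = card (verts P)"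
proof -
  note V = disjoint_union_verts[OF K(1)]
  have finV: "finite (verts P)" unfolding V using K(2) by (auto simp: simple_graph_def)
  have fin: "finite (edges P)" unfolding V
    by (rule finite_UN_I) (use simple_graph_finite_edges[OF K(2)] in auto)
  have card2: "card e = 2" if "e \<in> edges P" for e
    using that K(2) unfolding V simple_graph_def by blast
  have missing: "card (verts P - w ` {1..t}) + t = card (verts P)"
    if w: "\<And>i. i \<in> {1..t} \<Longrightarrow> w i \<in> verts (K i)" for w
  proof -
    have "inj_on w {1..t}" using w disjoint_union_disjoint[OF K(1)] by (metis inj_onI)
    then have "card (w ` {1..t}) = t" by (simp add: card_image)
    moreover have "w ` {1..t} \<subseteq> verts P" unfolding V using w by blast
    ultimately show ?thesis using finV
      by (metis card_Diff_subset card_mono finite_subset le_add_diff_inverse2)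
  qed
  have "\<exists>v M. v \<in> verts (K i) \<and> perfect_matching (delete_vertex (K i) v) M" if "i \<in> {1..t}" for i
    using ne[OF that] fc[OF that] unfolding factor_critical_def by blast
  then obtain v N where vN: "\<And>i. i \<in> {1..t} \<Longrightarrow> v i \<in> verts (K i)"
    "\<And>i. i \<in> {1..t} \<Longrightarrow> perfect_matching (delete_vertex (K i) (v i)) (N i)" by metis
  have N: "N i \<subseteq> edges (K i)" "\<forall>e \<in> N i. \<forall>f \<in> N i. e \<noteq> f \<longrightarrow> e \<inter> f = {}"
    "\<Union>(N i) = verts (K i) - {v i}" if "i \<in> {1..t}" for i
    using vN(2)[OF that] unfolding perfect_matching_def matching_def delete_vertex_def induced_def
    by auto
  define NN where "NN = (\<Union>i\<in>{1..t}. N i)"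
  have NN: "matching P NN" unfolding matching_def
  proof (intro conjI ballI impI)
    show "NN \<subseteq> edges P" unfolding V NN_def using N(1) by blast
    fix e f assume "e \<in> NN" "f \<in> NN" "e \<noteq> f"
    then obtain i j where i: "i \<in> {1..t}" "e \<in> N i" and j: "j \<in> {1..t}" "f \<in> N j"
      unfolding NN_def by blast
    have "e \<subseteq> verts (K i)" "f \<subseteq> verts (K j)" using N(3)[OF i(1)] N(3)[OF j(1)] i j by blast+
    then show "e \<inter> f = {}"
      using N(2)[OF i(1)] i j \<open>e \<noteq> f\<close> disjoint_union_disjoint[OF K(1) i(1) j(1)] by blast
  qed
  have "\<Union>NN = verts P - v ` {1..t}"
  proof -
    have "\<Union>NN = (\<Union>i\<in>{1..t}. \<Union>(N i))" unfolding NN_def by blast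
    also have "\<dots> = (\<Union>i\<in>{1..t}. verts (K i) - {v i})" by (rule SUP_cong[OF refl N(3)])
    also have "\<dots> = verts P - v ` {1..t}"
    proof -
      have "v j \<in> verts (K i) \<Longrightarrow> v j = v i" if "i \<in> {1..t}" "j \<in> {1..t}" for i j
        using vN(1)[OF that(2)] disjoint_union_disjoint[OF K(1) that] by blast
      then show ?thesis unfolding V by blast
    qed
    finally show ?thesis .
  qed
  moreover have "card (\<Union>NN) = 2 * card NN"
    by (rule card_Union_matching) (use NN fin card2 in \<open>auto simp: matching_def intro: finite_subset\<close>)
  ultimately have cardNN: "2 * card NN + t = card (verts P)" using missing[OF vN(1)] by simp
  have le: "2 * card M + t \<le> card (verts P)" if M: "matching P M" for M
  proof -
    have Msub: "M \<subseteq> edges P" and Mdis: "\<forall>e \<in> M. \<forall>f \<in> M. e \<noteq> f \<longrightarrow> e \<inter> f = {}"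
      using M unfolding matching_def by auto
    have finM: "finite M" using Msub fin by (rule finite_subset)
    have "\<exists>w. w \<in> verts (K i) \<and> w \<notin> \<Union>M" if i: "i \<in> {1..t}" for i
    proof (rule ccontr)
      assume "\<not> ?thesis"
      then have cov: "verts (K i) \<subseteq> \<Union>M" by blast
      define L where "L = {e \<in> M. e \<inter> verts (K i) \<noteq> {}}"
      have Lsub: "e \<subseteq> verts (K i)" if "e \<in> L" for e
      proof -
        have "e \<in> edges (K i)"
          using that Msub unfolding L_def by (intro disjoint_union_edge[OF K i]) auto
        then show ?thesis using simple_edge_nonempty[OF K(2)[OF i]] by blast
      qed
      have "\<Union>L = verts (K i)"
      proof
        show "\<Union>L \<subseteq> verts (K i)" using Lsub by blast
        show "verts (K i) \<subseteq> \<Union>L"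
        proof
          fix x assume x: "x \<in> verts (K i)"
          then obtain e where "e \<in> M" "x \<in> e" using cov by blast
          then show "x \<in> \<Union>L" using x unfolding L_def by blast
        qed
      qed
      moreover have "card (\<Union>L) = 2 * card L"
        by (rule card_Union_matching) (use finM Mdis Msub card2 in \<open>auto simp: L_def\<close>)
      moreover have "card (\<Union>(N i)) = 2 * card (N i)"
      proof (rule card_Union_matching)
        have "N i \<subseteq> edges P" unfolding V using N(1)[OF i] i by blast
        then show "finite (N i)" "\<And>e. e \<in> N i \<Longrightarrow> card e = 2" using fin card2 finite_subset by auto
      qed (use N(2)[OF i] in auto)
      moreover have "card (verts (K i) - {v i}) + 1 = card (verts (K i))"
        using vN(1)[OF i] K(2)[OF i] unfolding simple_graph_def
        by (metis Suc_eq_plus1 card_Suc_Diff1)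
      \<comment> \<open>Covering all of \<open>K i\<close> would make its order even, whereas
        \<open>N i\<close> shows that it is odd.\<close>
      ultimately have "2 * card L = 2 * card (N i) + 1" using N(3)[OF i] by simp
      then show False by presburger
    qed
    then obtain w where w: "\<And>i. i \<in> {1..t} \<Longrightarrow> w i \<in> verts (K i) \<and> w i \<notin> \<Union>M" by metis
    have "\<Union>M \<subseteq> verts P - w ` {1..t}"
    proof -
      have "e \<subseteq> verts P" if e: "e \<in> M" for e
      proof -
        obtain i where i: "i \<in> {1..t}" "e \<in> edges (K i)" using e Msub unfolding V(2) by blast
        then show ?thesis using simple_edge_nonempty[OF K(2)[OF i(1)] i(2)] unfolding V(1) by blast
      qed
      then have "\<Union>M \<subseteq> verts P" by blast
      then show ?thesis using w by blast
    qed
    then have "card (\<Union>M) \<le> card (verts P - w ` {1..t})" using finV by (intro card_mono) auto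
    moreover have "card (\<Union>M) = 2 * card M"
      by (rule card_Union_matching) (use finM Mdis Msub card2 in auto)
    ultimately show ?thesis using missing[of w] w by force
  qed
  have "matching_number P = card NN"
    unfolding matching_number_def
  proof (rule Max_eqI)
    have "{card M |M. matching P M} \<subseteq> card ` Pow (edges P)" unfolding matching_def by auto
    then show "finite {card M |M. matching P M}" using fin by (meson finite_Pow_iff finite_imageI finite_subset)
    show "y \<le> card NN" if "y \<in> {card M |M. matching P M}" for y
      using that le cardNN by fastforce
  qed (use NN in blast)
  then show ?thesis using cardNN by simp
qed

section \<open>Replications and components of disjoint unions\<close>

lemma replication_cong:
  assumes "simple_graph H" "\<And>v. v \<in> verts H \<Longrightarrow> b v = b' v"
  shows "replication b H = replication b' H"
proof -
  have 1: "copies b (verts H) = copies b' (verts H)" using assms(2) by (auto simp: copies_def)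
  have "{u, v} \<in> edges H \<and> l \<in> {1..b u} \<and> m \<in> {1..b v} \<longleftrightarrow>
     {u, v} \<in> edges H \<and> l \<in> {1..b' u} \<and> m \<in> {1..b' v}" for u v l m
    using simple_edge[OF assms(1)] assms(2) by metis
  then have "copy_edges b (edges H) = copy_edges b' (edges H)" unfolding copy_edges_def by presburger
  then show ?thesis using 1 by (simp add: replication_eq)
qed

lemma disjoint_union_replication:
  assumes "disjoint_union_of t K P"
  shows "disjoint_union_of t (\<lambda>i. replication b (K i)) (replication b P)"
proof -
  have "replication b P = graph_Union ((\<lambda>i. replication b (K i)) ` {1..t})"
  proof -
    have "copy_edges b (\<Union>i\<in>{1..t}. edges (K i)) = (\<Union>i\<in>{1..t}. copy_edges b (edges (K i)))"
      unfolding copy_edges_def by blast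
    moreover have "copies b (\<Union>i\<in>{1..t}. verts (K i)) = (\<Union>i\<in>{1..t}. copies b (verts (K i)))"
      unfolding copies_def by blast
    ultimately show ?thesis
      unfolding replication_eq graph_Union_def disjoint_union_verts[OF assms] by simp
  qed
  moreover have "verts (replication b (K i)) \<inter> verts (replication b (K j)) = {}"
    if "i \<in> {1..t}" "j \<in> {1..t}" "i \<noteq> j" for i j
    using disjoint_union_disjoint[OF assms that(1,2)] that(3) by (auto simp: replication_def)
  ultimately show ?thesis unfolding disjoint_union_of_def by blast
qed

text \<open>Turns the sums over components in \<open>phi\<close> and \<open>psi\<close> into sums
  over indices; injectivity holds because the parts are nonempty and disjoint.\<close>

lemma components_disjoint_union:
  assumes K: "disjoint_union_of t K P" "\<And>i. i \<in> {1..t} \<Longrightarrow> simple_graph (K i)"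
    and conn: "\<And>i. i \<in> {1..t} \<Longrightarrow> connected_graph (K i)"
  shows "components P = K ` {1..t}" "inj_on K {1..t}"
proof -
  note V = disjoint_union_verts[OF K(1)]
  have comp: "induced P {v \<in> verts P. reachable P u v} = K i"
    if i: "i \<in> {1..t}" and u: "u \<in> verts (K i)" for i u
  proof -
    have sub: "edges (K i) \<subseteq> edges P" "verts (K i) \<subseteq> verts P" unfolding V using i by auto
    have "{v \<in> verts P. reachable P u v} = verts (K i)"
    proof
      show "{v \<in> verts P. reachable P u v} \<subseteq> verts (K i)"
        using disjoint_union_reach[OF K i _ u] unfolding reachable_def adj_def by blast
      have "reachable P u v" if v: "v \<in> verts (K i)" for v
      proof -
        have "(u, v) \<in> (adj (edges (K i)))\<^sup>*"
          using conn[OF i] u v unfolding connected_graph_def reachable_def adj_def by blast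
        then show ?thesis using adj_rtrancl_mono[OF sub(1)] unfolding reachable_def adj_def by blast
      qed
      then show "verts (K i) \<subseteq> {v \<in> verts P. reachable P u v}" using sub(2) by blast
    qed
    moreover have "{e \<in> edges P. e \<subseteq> verts (K i)} = edges (K i)"
    proof
      show "{e \<in> edges P. e \<subseteq> verts (K i)} \<subseteq> edges (K i)"
      proof
        fix e assume e: "e \<in> {e \<in> edges P. e \<subseteq> verts (K i)}"
        then obtain j where "j \<in> {1..t}" "e \<in> edges (K j)" unfolding V by blast
        then have "e \<noteq> {}" using simple_edge_nonempty[OF K(2)] by blast
        then show "e \<in> edges (K i)" using e by (intro disjoint_union_edge[OF K i]) auto
      qed
      show "edges (K i) \<subseteq> {e \<in> edges P. e \<subseteq> verts (K i)}"
        using sub simple_edge_nonempty[OF K(2)[OF i]] by blast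
    qed
    ultimately show ?thesis unfolding induced_def using sub(2)
      by (cases "K i") (auto simp: Int_absorb1)
  qed
  have ne: "verts (K i) \<noteq> {}" if "i \<in> {1..t}" for i
    using conn[OF that] unfolding connected_graph_def by blast
  show "components P = K ` {1..t}"
  proof
    show "components P \<subseteq> K ` {1..t}" unfolding components_def V(1) using comp unfolding V(1) by blast
    show "K ` {1..t} \<subseteq> components P"
    proof
      fix H assume "H \<in> K ` {1..t}"
      then obtain i where i: "i \<in> {1..t}" "H = K i" by blast
      obtain u where u: "u \<in> verts (K i)" using ne[OF i(1)] by blast
      then have "u \<in> verts P" unfolding V using i by blast
      then show "H \<in> components P" unfolding components_def
        using comp[OF i(1) u] i(2) by (intro image_eqI[of _ _ u]) auto
    qed
  qed
  show "inj_on K {1..t}" using ne disjoint_union_disjoint[OF K(1)] by (metis inj_onI ex_in_conv)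
qed

lemma is_minimum_unique: "is_minimum k S \<Longrightarrow> is_minimum l S \<Longrightarrow> k = l"
  unfolding is_minimum_def by (simp add: order_antisym)

lemma is_minimumI: "a \<in> S \<Longrightarrow> a \<le> k \<Longrightarrow> (\<And>x. x \<in> S \<Longrightarrow> k \<le> x) \<Longrightarrow> is_minimum k S"
  unfolding is_minimum_def by (metis order_antisym)

theorem theorem3p8:
  fixes t :: nat and Gs :: "nat \<Rightarrow> 'a ugraph" and G :: "'a ugraph"
  assumes "\<And>i. i \<in> {1..t} \<Longrightarrow> simple_graph (Gs i)"
    and "\<And>i. i \<in> {1..t} \<Longrightarrow> connected_graph (Gs i)"
    and "\<And>i. i \<in> {1..t} \<Longrightarrow> \<not> bipartite (Gs i)"
    and "disjoint_union_of t Gs G"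
  shows "is_minimum (nu_star G)
           {real (matching_number (replication (\<lambda>v. a v + 1) G)) | a :: 'a \<Rightarrow> nat.
              matching_critical (replication (\<lambda>v. a v + 1) G)}
       \<and> (\<forall>k :: nat. phi G + psi G = k \<longleftrightarrow>
            is_minimum k {(\<Sum>v \<in> verts G. a v) | a :: 'a \<Rightarrow> nat.
              matching_critical (replication (\<lambda>v. a v + 1) G)})"
proof -
  note simple = assms(1) and conn = assms(2) and nonbip = assms(3) and G = assms(4)
  let ?R = "\<lambda>a. replication (\<lambda>v. a v + 1)"
  let ?cost = "\<lambda>i. phi_connected (Gs i) + card (bridges (Gs i))"
  \<comment> \<open>An edgeless graph is bipartite. This excludes one-vertex components, for which
    \<open>phi_connected\<close> has no meaning.\<close>
  have ne: "edges (Gs i) \<noteq> {}" if "i \<in> {1..t}" for i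
    using nonbip[OF that] unfolding bipartite_def by auto
  have ne': "verts (Gs i) \<noteq> {}" if "i \<in> {1..t}" for i
    using conn[OF that] unfolding connected_graph_def by blast
  have comps: "components G = Gs ` {1..t}" "inj_on Gs {1..t}"
    by (rule components_disjoint_union[OF G simple conn], assumption+)+
  have sumG: "(\<Sum>v\<in>verts G. f v) = (\<Sum>i\<in>{1..t}. \<Sum>v\<in>verts (Gs i). f v)" for f :: "'a \<Rightarrow> nat"
    by (rule disjoint_union_sum[OF G simple])
  have cost: "phi G + psi G = (\<Sum>i\<in>{1..t}. ?cost i)"
    unfolding phi_def psi_def comps(1) sum.reindex[OF comps(2)] by (simp add: sum.distrib)
  have comps_card: "card (components G) = t" unfolding comps(1) using card_image[OF comps(2)] by simp
  have R: "disjoint_union_of t (\<lambda>i. ?R a (Gs i)) (?R a G)" for a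
    by (rule disjoint_union_replication[OF G])
  have Rsimp: "simple_graph (?R a (Gs i))" if "i \<in> {1..t}" for a i
    by (rule simple_graph_replication[OF simple[OF that]])
  \<comment> \<open>All multiplicities are at least 1, so each replicated component stays connected
    and matching-criticality can be tested part by part.\<close>
  have mc: "matching_critical (?R a G) \<longleftrightarrow> (\<forall>i\<in>{1..t}. factor_critical (?R a (Gs i)))" for a
  proof
    assume m: "matching_critical (?R a G)"
    show "\<forall>i\<in>{1..t}. factor_critical (?R a (Gs i))"
    proof
      fix i assume i: "i \<in> {1..t}"
      show "factor_critical (?R a (Gs i))"
        by (rule factor_critical_of_matching_critical[OF R[of a] Rsimp i _ m])
          (use connected_replication[OF simple[OF i] conn[OF i] ne[OF i], of "\<lambda>v. a v + 1"] in auto)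
    qed
  next
    assume "\<forall>i\<in>{1..t}. factor_critical (?R a (Gs i))"
    then show "matching_critical (?R a G)"
      unfolding matching_critical_def using R[of a] Rsimp by blast
  qed
  have sum1: "(\<Sum>v\<in>X. a v + 1) = (\<Sum>v\<in>X. a v) + card X" for a :: "'a \<Rightarrow> nat" and X
    by (subst sum.distrib) simp
  have finG: "finite (verts G)"
    unfolding disjoint_union_verts[OF G] using simple by (auto simp: simple_graph_def)
  \<comment> \<open>On matching-critical replications the matching number depends only on the sum of
    \<open>a\<close> and increases with it, so one vector attains both minima.\<close>
  have nu: "2 * matching_number (?R a G) + t = card (verts G) + (\<Sum>v\<in>verts G. a v)"
    if "matching_critical (?R a G)" for a
  proof -
    have "2 * matching_number (?R a G) + t = card (verts (?R a G))"
    proof (rule matching_number_disjoint_union[OF R Rsimp])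
      show "verts (?R a (Gs i)) \<noteq> {}" if "i \<in> {1..t}" for i
        using ne'[OF that] by (auto simp: replication_def Sigma_empty_iff)
      show "factor_critical (?R a (Gs i))" if "i \<in> {1..t}" for i
        using \<open>matching_critical (?R a G)\<close> mc that by blast
    qed
    also have "\<dots> = (\<Sum>v\<in>verts G. a v + 1)"
      using finG by (simp add: replication_def)
    finally show ?thesis unfolding sum1 by simp
  qed
  have lower: "phi G + psi G \<le> (\<Sum>v\<in>verts G. a v)" if m: "matching_critical (?R a G)" for a
    unfolding cost sumG
  proof (rule sum_mono)
    fix i assume i: "i \<in> {1..t}"
    obtain r c D where b: "builds {r} {} c D (verts (Gs i)) (edges (Gs i))"
      "c + card (verts (Gs i)) \<le> (\<Sum>v\<in>verts (Gs i). a v + 1)"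
      using factor_critical_replication_builds[OF simple[OF i] ne'[OF i], of "\<lambda>v. a v + 1"] mc m i by auto
    then have "c \<le> (\<Sum>v\<in>verts (Gs i). a v)" unfolding sum1 by simp
    then show "?cost i \<le> (\<Sum>v\<in>verts (Gs i). a v)"
      using phi_plus_bridges_le(2)[OF b(1) ne[OF i]] by linarith
  qed
  have upper: "\<exists>a. matching_critical (?R a G) \<and> (\<Sum>v\<in>verts G. a v) \<le> phi G + psi G"
  proof -
    have "\<exists>b :: 'a \<Rightarrow> nat. (\<forall>v. b v \<ge> 1) \<and> factor_critical (replication b (Gs i)) \<and>
        (\<Sum>v\<in>verts (Gs i). b v) \<le> card (verts (Gs i)) + ?cost i" if i: "i \<in> {1..t}" for i
    proof -
      obtain r c D where b: "builds {r} {} c D (verts (Gs i)) (edges (Gs i))" "c \<le> ?cost i"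
        using builds_phi_plus_bridges[OF simple[OF i] conn[OF i] ne[OF i]] .
      obtain b' :: "'a \<Rightarrow> nat" where "\<And>v. b' v \<ge> 1" "factor_critical (replication b' (Gs i))"
        "(\<Sum>v\<in>verts (Gs i). b' v) \<le> card (verts (Gs i)) + c"
        using builds_factor_critical_replication[OF b(1) nonbip[OF i]] by blast
      then show ?thesis using b(2) by (intro exI[of _ b']) auto
    qed
    then obtain b :: "nat \<Rightarrow> 'a \<Rightarrow> nat" where b: "\<And>i v. i \<in> {1..t} \<Longrightarrow> b i v \<ge> 1"
      "\<And>i. i \<in> {1..t} \<Longrightarrow> factor_critical (replication (b i) (Gs i))"
      "\<And>i. i \<in> {1..t} \<Longrightarrow> (\<Sum>v\<in>verts (Gs i). b i v) \<le> card (verts (Gs i)) + ?cost i"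
      by metis
    \<comment> \<open>The value is taken from the part containing \<open>v\<close>; truncated
      subtraction loses nothing because \<open>b i v\<close> is at least 1.\<close>
    define a where "a v = b (SOME i. i \<in> {1..t} \<and> v \<in> verts (Gs i)) v - 1" for v
    have a: "a v + 1 = b i v" if i: "i \<in> {1..t}" "v \<in> verts (Gs i)" for i v
    proof -
      have "(SOME i. i \<in> {1..t} \<and> v \<in> verts (Gs i)) = i"
        using i disjoint_union_disjoint[OF G] by (intro some_equality) blast+
      then show ?thesis using b(1)[OF i(1), of v] by (simp add: a_def)
    qed
    have "?R a (Gs i) = replication (b i) (Gs i)" if "i \<in> {1..t}" for i
      by (rule replication_cong[OF simple[OF that] a[OF that]])
    then have "matching_critical (?R a G)" using mc b(2) by simp
    moreover have "(\<Sum>v\<in>verts G. a v) \<le> phi G + psi G"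
      unfolding cost sumG
    proof (rule sum_mono)
      fix i assume i: "i \<in> {1..t}"
      have "(\<Sum>v\<in>verts (Gs i). a v + 1) = (\<Sum>v\<in>verts (Gs i). b i v)"
        using a[OF i] by (intro sum.cong) auto
      then show "(\<Sum>v\<in>verts (Gs i). a v) \<le> ?cost i" using b(3)[OF i] unfolding sum1 by simp
    qed
    ultimately show ?thesis by blast
  qed
  then obtain a0 where a0: "matching_critical (?R a0 G)" "(\<Sum>v\<in>verts G. a0 v) \<le> phi G + psi G"
    by blast
  have minimum: "is_minimum (phi G + psi G) {(\<Sum>v \<in> verts G. a v) | a. matching_critical (?R a G)}"
    by (rule is_minimumI[of "\<Sum>v\<in>verts G. a0 v"]) (use a0 lower in auto)
  have real_nu: "real (matching_number (?R a G)) =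
      (real (card (verts G)) + real (\<Sum>v\<in>verts G. a v) - real t) / 2"
    if "matching_critical (?R a G)" for a
  proof -
    have "real (2 * matching_number (?R a G) + t) = real (card (verts G) + (\<Sum>v\<in>verts G. a v))"
      using nu[OF that] by (rule arg_cong)
    then show ?thesis unfolding of_nat_add of_nat_mult by (simp add: field_simps)
  qed
  have star: "nu_star G = (real (card (verts G)) + real (phi G + psi G) - real t) / 2"
    unfolding nu_star_def comps_card by simp
  have "is_minimum (nu_star G) {real (matching_number (?R a G)) | a. matching_critical (?R a G)}"
  proof (rule is_minimumI)
    show "real (matching_number (?R a0 G)) \<in> {real (matching_number (?R a G)) | a. matching_critical (?R a G)}"
      using a0(1) by blast
    show "real (matching_number (?R a0 G)) \<le> nu_star G"
      unfolding real_nu[OF a0(1)] star using a0(2) by (simp del: of_nat_sum of_nat_add)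
    fix x assume "x \<in> {real (matching_number (?R a G)) | a. matching_critical (?R a G)}"
    then obtain a where a: "x = real (matching_number (?R a G))" "matching_critical (?R a G)" by blast
    show "nu_star G \<le> x"
      unfolding a(1) real_nu[OF a(2)] star using lower[OF a(2)] by (simp del: of_nat_sum of_nat_add)
  qed
  \<comment> \<open>The minimum exists and equals \<open>phi G + psi G\<close>; as a set has only
    one minimum, both directions of the equivalence follow for every \<open>k\<close>.\<close>
  then show ?thesis using minimum is_minimum_unique by blast
qed


end
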